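(* Let $s,t\in\mathbb N_0$. For any $f\in\mathscr D_{(s,t+1)}$ it holds that $f\in D_S\cap D_{T^*}$ and $$\frac{t+1}{2r^2}\,\|f\|^2_{L^2_{(s,t+1)}(\ell^2,P_r)}\le\|T^*f\|^2_{L^2_{(s,t)}(\ell^2,P_r)}+\|Sf\|^2_{L^2_{(s,t+2)}(\ell^2,P_r)} .$$
   Context: Fix $r>0$ and positive numbers $(a_i)_{i\ge1}$ with $\sum_ia_i<\infty$. Here $\ell^2$ is the space of complex sequences $\mathbf z=(z_i)_{i\in\mathbb N}$, $z_i=x_i+\sqrt{-1}y_i$, with $\sum|z_i|^2<\infty$. $P_r$ is the Borel probability measure on $\ell^2$ obtained by restricting to $\ell^2$ the product measure $\prod_i(\mathcal N_{ra_i}\times\mathcal N_{ra_i})$ on $\mathbb C^{\mathbb N}$ (real and imaginary parts), where $\mathcal N_a(dx)=\frac1{\sqrt{2\pi a^2}}e^{-x^2/(2a^2)}dx$. $\mathscr C_c^\infty$ is the union over $n$ of the complex-valued $C_c^\infty$ functions on $\mathbb C^n$, viewed as cylinder functions on $\ell^2$ of $(z_1,\dots,z_n)$. $\partial_i=\frac12(D_{x_i}-\sqrt{-1}D_{y_i})$ and $\delta_i\varphi=\partial_i\varphi-\frac{\overline{z_i}}{2r^2a_i^2}\varphi$. For strictly increasing multi-indices $I=(i_1,\dots,i_s)$, $J=(j_1,\dots,j_t)$ put $\mathbf a^{I,J}=\prod_la_{i_l}^2\prod_la_{j_l}^2$. An $(s,t)$-form is a formal sum $f=\sum'_{|I|=s}\sum'_{|J|=t}f_{I,J}\,dz_I\wedge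 d\overline{z_J}$ over strictly increasing multi-indices, i.e. a family of coefficient functions on $\ell^2$. $L^2_{(s,t)}(\ell^2,P_r)$ is the Hilbert space of such forms with $f_{I,J}\in L^2(\ell^2,P_r)$ and $\|f\|^2=\sum'_{I,J}\mathbf a^{I,J}\int|f_{I,J}|^2dP_r<\infty$. For $j\in\mathbb N$ and strictly increasing $J,K$ with $|J|=t,|K|=t+1$: $\varepsilon^K_{j,J}=0$ unless $K=J\cup\{j\}$ as sets, in which case it is the sign of the permutation taking $(j,j_1,\dots,j_t)$ to $K$. $f\in L^2_{(s,t)}(\ell^2,P_r)$ is in $D_{\overline\partial}$ if for all $I,K$ ($|I|=s,|K|=t+1$) there is $g_{I,K}\in L^2(\ell^2,P_r)$ with $\int g_{I,K}\overline\varphi\,dP_r=-\int\sum_{i\ge1}\sum'_{|J|=t}\varepsilon^K_{i,J}f_{I,J}\,\overline{\delta_i\varphi}\,dP_r$ for all $\varphi\in\mathscr C_c^\infty$, and $\sum'_{I,K}\mathbf a^{I,K}\int|g_{I,K}|^2dP_r<\infty$; then $\overline\partial f=(-1)^s\sum'_{I,K}g_{I,K}\,dz_I\wedge d\overline{z_K}$. $T$ is $\overline\partial$ as a (densely defined, closed) operator $L^2_{(s,t)}\to L^2_{(s,t+1)}$ with domain $D_T$, $S$ is $\overline\partial$ as an operator $L^2_{(s,t+1)}\to L^2_{(s,t+2)}$ with domain $D_S$; $T^*$ is the Hilbert space adjoint of $T$ with domain $D_{T^*}$. $\mathscr D_{(s,t)}$ is the set of $(s,t)$-forms with only finitely many non-zero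 coefficients, all of which lie in $\mathscr C_c^\infty$. *)

theory Defs
  imports "HOL-Probability.Probability" "HOL-Combinatorics.Permutations"
begin

text \<open>
  Coordinates are numbered from 0. A function on \<open>\<ell>\<^sup>2\<close> is represented by a total function on
  \<^typ>\<open>nat \<Rightarrow> complex\<close>, and an element of an \<open>L\<^sup>2\<close>-space by any representative of its
  almost-everywhere class.
\<close>

type_synonym cseq = "nat \<Rightarrow> complex"

definition ell2 :: "cseq set" where
  "ell2 = {z. summable (\<lambda>i. (cmod (z i))\<^sup>2)}"

definition gaussian :: "real \<Rightarrow> real measure" where
  "gaussian \<sigma> = density lborel (\<lambda>x. ennreal (normal_density 0 \<sigma> x))"

definition complex_gaussian :: "real \<Rightarrow> complex measure" where
  "complex_gaussian \<sigma> = distr (gaussian \<sigma> \<Otimes>\<^sub>M gaussian \<sigma>) borel (\<lambda>(x, y). Complex x y)"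

text \<open>
  The \<open>\<sigma>\<close>-algebra below is the trace on \<open>\<ell>\<^sup>2\<close> of the product \<open>\<sigma>\<close>-algebra, which is the Borel
  \<open>\<sigma>\<close>-algebra of the separable space \<open>\<ell>\<^sup>2\<close>.
\<close>

definition ell2_measure :: "real \<Rightarrow> (nat \<Rightarrow> real) \<Rightarrow> cseq measure" where
  "ell2_measure r a = restrict_space (\<Pi>\<^sub>M i\<in>UNIV. complex_gaussian (r * a i)) ell2"


subsection \<open>Smooth compactly supported cylinder functions\<close>

text \<open>The derivative in the i-th coordinate in the real direction \<open>v\<close>, where \<open>v = 1\<close> gives
  \<open>D\<^sub>x\<close> and \<open>v = \<i>\<close> gives \<open>D\<^sub>y\<close>.\<close>

definition pderiv_dir :: "complex \<Rightarrow> nat \<Rightarrow> (cseq \<Rightarrow> complex) \<Rightarrow> cseq \<Rightarrow> complex" where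
  "pderiv_dir v i \<phi> z = vector_derivative (\<lambda>t::real. \<phi> (z(i := z i + t *\<^sub>R v))) (at 0)"

definition has_pderivs :: "(cseq \<Rightarrow> complex) \<Rightarrow> bool" where
  "has_pderivs \<phi> \<longleftrightarrow>
     (\<forall>v\<in>{1, \<i>}. \<forall>i z. (\<lambda>t::real. \<phi> (z(i := z i + t *\<^sub>R v))) differentiable (at 0))"

definition iter_pderiv :: "(complex \<times> nat) list \<Rightarrow> (cseq \<Rightarrow> complex) \<Rightarrow> cseq \<Rightarrow> complex" where
  "iter_pderiv ds \<phi> = foldr (\<lambda>(v, i). pderiv_dir v i) ds \<phi>"

text \<open>
  All iterated partial derivatives exist and are continuous. Continuity refers to the product
  topology; for a function of the first \<open>n\<close> coordinates this is continuity on \<open>\<complex>\<^sup>n\<close>.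
\<close>

definition smooth :: "(cseq \<Rightarrow> complex) \<Rightarrow> bool" where
  "smooth \<phi> \<longleftrightarrow>
     (\<forall>ds. set ds \<subseteq> {1, \<i>} \<times> UNIV \<longrightarrow>
        continuous_on UNIV (iter_pderiv ds \<phi>) \<and> has_pderivs (iter_pderiv ds \<phi>))"

text \<open>
  The support in \<open>\<complex>\<^sup>n\<close> is compact iff it is bounded. The condition \<open>0 < n\<close> matters: \<open>n = 0\<close> would
  admit the nonzero constants.
\<close>

definition Cc_smooth :: "(cseq \<Rightarrow> complex) set" where
  "Cc_smooth = {\<phi>. smooth \<phi> \<and>
     (\<exists>n>0. (\<forall>z w. (\<forall>i<n. z i = w i) \<longrightarrow> \<phi> z = \<phi> w) \<and>
            (\<exists>R. \<forall>z. (\<exists>i<n. R < cmod (z i)) \<longrightarrow> \<phi> z = 0))}"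

definition del :: "nat \<Rightarrow> (cseq \<Rightarrow> complex) \<Rightarrow> cseq \<Rightarrow> complex" where
  "del i \<phi> z = (pderiv_dir 1 i \<phi> z - \<i> * pderiv_dir \<i> i \<phi> z) / 2"

definition delta :: "real \<Rightarrow> (nat \<Rightarrow> real) \<Rightarrow> nat \<Rightarrow> (cseq \<Rightarrow> complex) \<Rightarrow> cseq \<Rightarrow> complex" where
  "delta r a i \<phi> z = del i \<phi> z - cnj (z i) / complex_of_real (2 * r\<^sup>2 * (a i)\<^sup>2) * \<phi> z"


subsection \<open>Forms\<close>

definition multi_indices :: "nat \<Rightarrow> nat list set" where
  "multi_indices s = {I. length I = s \<and> sorted_wrt (<) I}"

text \<open>Only the coefficients at \<open>I \<in> multi_indices s\<close>, \<open>J \<in> multi_indices t\<close> of an \<open>(s,t)\<close>-form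
  are meaningful.\<close>

type_synonym form = "nat list \<Rightarrow> nat list \<Rightarrow> cseq \<Rightarrow> complex"

definition weight :: "(nat \<Rightarrow> real) \<Rightarrow> nat list \<Rightarrow> nat list \<Rightarrow> real" where
  "weight a I J = prod_list (map (\<lambda>i. (a i)\<^sup>2) I) * prod_list (map (\<lambda>j. (a j)\<^sup>2) J)"

definition L2 :: "real \<Rightarrow> (nat \<Rightarrow> real) \<Rightarrow> (cseq \<Rightarrow> complex) set" where
  "L2 r a = {u \<in> borel_measurable (ell2_measure r a). integrable (ell2_measure r a) (\<lambda>z. (cmod (u z))\<^sup>2)}"

definition L2_forms :: "real \<Rightarrow> (nat \<Rightarrow> real) \<Rightarrow> nat \<Rightarrow> nat \<Rightarrow> form set" where
  "L2_forms r a s t =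
     {f. (\<forall>I\<in>multi_indices s. \<forall>J\<in>multi_indices t. f I J \<in> L2 r a) \<and>
         (\<lambda>(I, J). weight a I J * (\<integral>z. (cmod (f I J z))\<^sup>2 \<partial>ell2_measure r a))
           summable_on (multi_indices s \<times> multi_indices t)}"

definition form_norm_sq :: "real \<Rightarrow> (nat \<Rightarrow> real) \<Rightarrow> nat \<Rightarrow> nat \<Rightarrow> form \<Rightarrow> real" where
  "form_norm_sq r a s t f =
     (\<Sum>\<^sub>\<infinity>(I, J)\<in>multi_indices s \<times> multi_indices t.
        weight a I J * (\<integral>z. (cmod (f I J z))\<^sup>2 \<partial>ell2_measure r a))"

definition form_inner :: "real \<Rightarrow> (nat \<Rightarrow> real) \<Rightarrow> nat \<Rightarrow> nat \<Rightarrow> form \<Rightarrow> form \<Rightarrow> complex" where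
  "form_inner r a s t f g =
     (\<Sum>\<^sub>\<infinity>(I, J)\<in>multi_indices s \<times> multi_indices t.
        complex_of_real (weight a I J) * (\<integral>z. f I J z * cnj (g I J z) \<partial>ell2_measure r a))"

definition smooth_forms :: "nat \<Rightarrow> nat \<Rightarrow> form set" where
  "smooth_forms s t =
     {f. (\<forall>I\<in>multi_indices s. \<forall>J\<in>multi_indices t. f I J \<in> Cc_smooth) \<and>
         finite {(I, J) \<in> multi_indices s \<times> multi_indices t. f I J \<noteq> (\<lambda>_. 0)}}"

text \<open>Used for \<open>length K = length J + 1\<close>, so that \<open>set K = insert j (set J)\<close> forces \<open>j \<notin> set J\<close>.\<close>

definition eps :: "nat list \<Rightarrow> nat \<Rightarrow> nat list \<Rightarrow> int" where
  "eps K j J =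
     (if set K = insert j (set J)
      then sign (THE p. p permutes {..<length K} \<and> permute_list p (j # J) = K)
      else 0)"


subsection \<open>The operator dbar and its adjoint\<close>

text \<open>For fixed \<open>I\<close>, \<open>K\<close> the sums below have only finitely many nonzero terms.\<close>

definition is_weak_dbar :: "real \<Rightarrow> (nat \<Rightarrow> real) \<Rightarrow> nat \<Rightarrow> nat \<Rightarrow> form \<Rightarrow> form \<Rightarrow> bool" where
  "is_weak_dbar r a s t f g \<longleftrightarrow>
     g \<in> L2_forms r a s (t + 1) \<and>
     (\<forall>I\<in>multi_indices s. \<forall>K\<in>multi_indices (t + 1). \<forall>\<phi>\<in>Cc_smooth.
        (\<integral>z. g I K z * cnj (\<phi> z) \<partial>ell2_measure r a) =
        - (\<integral>z. (\<Sum>\<^sub>\<infinity>i\<in>UNIV. \<Sum>\<^sub>\<infinity>J\<in>multi_indices t.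
                  of_int (eps K i J) * f I J z * cnj (delta r a i \<phi> z)) \<partial>ell2_measure r a))"

definition dbar_dom :: "real \<Rightarrow> (nat \<Rightarrow> real) \<Rightarrow> nat \<Rightarrow> nat \<Rightarrow> form set" where
  "dbar_dom r a s t = {f \<in> L2_forms r a s t. \<exists>g. is_weak_dbar r a s t f g}"

text \<open>The choices below are unique up to almost-everywhere equality of the coefficients: in
  \<open>dbar\<close> because \<open>Cc_smooth\<close> is dense in \<open>L2\<close>, in \<open>dbar_adj\<close> because \<open>dbar_dom\<close> is dense in
  \<open>L2_forms\<close>.\<close>

definition dbar :: "real \<Rightarrow> (nat \<Rightarrow> real) \<Rightarrow> nat \<Rightarrow> nat \<Rightarrow> form \<Rightarrow> form" where
  "dbar r a s t f = (\<lambda>I K z. (-1) ^ s * (SOME g. is_weak_dbar r a s t f g) I K z)"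

definition is_dbar_adj :: "real \<Rightarrow> (nat \<Rightarrow> real) \<Rightarrow> nat \<Rightarrow> nat \<Rightarrow> form \<Rightarrow> form \<Rightarrow> bool" where
  "is_dbar_adj r a s t f h \<longleftrightarrow>
     h \<in> L2_forms r a s t \<and>
     (\<forall>u\<in>dbar_dom r a s t.
        form_inner r a s (t + 1) (dbar r a s t u) f = form_inner r a s t u h)"

definition dbar_adj_dom :: "real \<Rightarrow> (nat \<Rightarrow> real) \<Rightarrow> nat \<Rightarrow> nat \<Rightarrow> form set" where
  "dbar_adj_dom r a s t = {f \<in> L2_forms r a s (t + 1). \<exists>h. is_dbar_adj r a s t f h}"

definition dbar_adj :: "real \<Rightarrow> (nat \<Rightarrow> real) \<Rightarrow> nat \<Rightarrow> nat \<Rightarrow> form \<Rightarrow> form" where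
  "dbar_adj r a s t f = (SOME h. is_dbar_adj r a s t f h)"

end

theory Submission
  imports Defs "HOL-Real_Asymp.Real_Asymp"
begin

text \<open>
  Gaussian integration by parts gives \<open>\<langle>dbar\<^sub>i u, v\<rangle> = - \<langle>u, \<delta>\<^sub>i v\<rangle>\<close>, and the commutator of \<open>dbar\<^sub>j\<close> with
  \<open>\<delta>\<^sub>i\<close> is multiplication by \<open>- 1 / (2 r\<^sup>2 a\<^sub>i\<^sup>2)\<close> for \<open>i = j\<close> and \<open>0\<close> otherwise. Hence
  \<open>\<langle>\<delta>\<^sub>i u, \<delta>\<^sub>j v\<rangle> = \<langle>dbar\<^sub>j u, dbar\<^sub>i v\<rangle> + [i = j] \<langle>u, v\<rangle> / (2 r\<^sup>2 a\<^sub>i\<^sup>2)\<close>. Expanding the squared norms of the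
  classical expressions for \<open>T\<^sup>* f\<close> and \<open>S f\<close>, the mixed terms cancel, the diagonal derivative terms
  are nonnegative, and the commutator terms add up to \<open>(t + 1) / (2 r\<^sup>2)\<close> times the squared norm
  of \<open>f\<close>.

  Any choice of \<open>T\<^sup>* f\<close> or \<open>S f\<close> has at least the norm of the classical expression, because the
  latter may itself be used (up to linear combinations) as a test element in the defining identity.
  This needs no density of the test functions. Coefficients of \<open>T\<^sup>* f\<close> contain \<open>cnj (z i)\<close>
  for coordinates on which \<open>f\<close> need not depend, so they are not compactly supported; the calculus is therefore
  done for functions all of whose derivatives have polynomial growth.
\<close>

subsection \<open>Directional derivatives of functions of infinitely many variables\<close>

text \<open>The values of \<open>dbar\<close> and \<open>dbar_adj\<close> are choices by
  \<open>SOME\<close>, accessible only through their defining identities. Both norms stand on the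
  larger side of the estimate, so lower bounds suffice: if g pairs with u as u does with itself,
  then 2 Re <g, u> \<le> ||g||^2 + ||u||^2 yields ||u||^2 \<le> ||g||^2. Origin of the constant: in
  the square of the coefficient of T* f at J, the commutator contributes a_i^4 / (2 r^2 a_i^2) =
  a_i^2 / (2 r^2) times the squared norm of the coefficient of f at J + i. The remaining a_i^2 turns
  the weight of J into the weight of K = J + i, which is why the constant does not depend on the
  sequence a, and each K of length t + 1 arises from t + 1 pairs (J, i). The mixed terms can cancel
  because moving both \<delta>'s across exchanges the directions i and j of differentiation. What is
  left in T* f at J then has the shape of a mixed term of S f at J + i + j.\<close>

abbreviation directions :: "complex set" where
  "directions \<equiv> {1, \<i>}"

text \<open>The one-parameter group of translations of coordinate i along v. Through this flow a
  derivative at time 0 can be transported to any time, and flows in two directions commute.\<close>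

definition shift :: "complex \<Rightarrow> nat \<Rightarrow> real \<Rightarrow> cseq \<Rightarrow> cseq" where
  "shift v i t z = z(i := z i + t *\<^sub>R v)"

lemma shift_0 [simp]: "shift v i 0 z = z"
  by (simp add: shift_def)

lemma shift_shift: "shift v i s (shift v i t z) = shift v i (s + t) z"
  by (simp add: shift_def algebra_simps fun_eq_iff)

lemma shift_commute: "shift v i s (shift w j t z) = shift w j t (shift v i s z)"
  by (simp add: shift_def algebra_simps fun_eq_iff)

lemma continuous_on_shift:
  assumes "continuous_on A s" "continuous_on A z"
  shows "continuous_on A (\<lambda>x. shift v i (s x) (z x))"
proof (rule continuous_on_coordinatewise_then_product)
  fix k
  have z: "continuous_on A (\<lambda>x. z x k)" for k
    by (rule continuous_on_product_then_coordinatewise[OF assms(2)])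
  show "continuous_on A (\<lambda>x. shift v i (s x) (z x) k)"
    using assms(1) z[of i] z[of k] by (cases "k = i") (auto simp: shift_def intro!: continuous_intros)
qed

lemma pderiv_dir_shift:
  "pderiv_dir v i \<phi> z = vector_derivative (\<lambda>t. \<phi> (shift v i t z)) (at 0)"
  by (simp add: pderiv_dir_def shift_def)

lemma has_pderivs_iff:
  "has_pderivs \<phi> \<longleftrightarrow> (\<forall>v\<in>directions. \<forall>i z.
     ((\<lambda>t. \<phi> (shift v i t z)) has_vector_derivative pderiv_dir v i \<phi> z) (at 0))"
  unfolding has_pderivs_def pderiv_dir_shift vector_derivative_works
  by (simp add: shift_def)

lemma pderiv_dir_0:
  assumes "has_pderivs \<phi>" "v \<in> directions"
  shows "((\<lambda>t. \<phi> (shift v i t z)) has_vector_derivative pderiv_dir v i \<phi> z) (at 0)"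
  using assms unfolding has_pderivs_iff by blast

lemma pderiv_dirI:
  assumes "((\<lambda>t. \<phi> (shift v i t z)) has_vector_derivative D) (at 0)"
  shows "pderiv_dir v i \<phi> z = D"
  using assms by (simp add: pderiv_dir_shift vector_derivative_at)

lemma has_pderivsI:
  assumes "\<And>v i z. v \<in> directions \<Longrightarrow> \<exists>D. ((\<lambda>t. \<phi> (shift v i t z)) has_vector_derivative D) (at 0)"
  shows "has_pderivs \<phi>"
  unfolding has_pderivs_iff using assms pderiv_dirI by blast

text \<open>By the group law, time t from z is time 0 from the shifted point. The derivatives,
  defined only at 0, thus become derivatives along whole lines, as the fundamental theorem of
  calculus requires.\<close>

lemma has_vector_derivative_shift:
  assumes "has_pderivs \<phi>" "v \<in> directions"
  shows "((\<lambda>t. \<phi> (shift v i t z)) has_vector_derivative pderiv_dir v i \<phi> (shift v i t z)) (at t)"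
proof -
  have "((\<lambda>h. \<phi> (shift v i h (shift v i t z))) has_vector_derivative pderiv_dir v i \<phi> (shift v i t z)) (at 0)"
    by (rule pderiv_dir_0[OF assms])
  then have "((\<lambda>s. \<phi> (shift v i (s + t) z)) has_vector_derivative pderiv_dir v i \<phi> (shift v i t z)) (at 0)"
    by (simp add: shift_shift)
  moreover have "((\<lambda>s. s - t) has_vector_derivative 1) (at t)"
    by (auto intro!: derivative_eq_intros)
  ultimately show ?thesis
    using vector_diff_chain_at[of "\<lambda>s. s - t" 1 t "\<lambda>s. \<phi> (shift v i (s + t) z)"] by (simp add: o_def)
qed

lemma pderiv_dir_lincomb:
  assumes "has_pderivs \<phi>" "has_pderivs \<psi>"
  shows "has_pderivs (\<lambda>z. c * \<phi> z + d * \<psi> z)"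
    and "v \<in> directions \<Longrightarrow> pderiv_dir v i (\<lambda>z. c * \<phi> z + d * \<psi> z) z =
      c * pderiv_dir v i \<phi> z + d * pderiv_dir v i \<psi> z"
proof -
  have *: "((\<lambda>t. c * \<phi> (shift v i t z) + d * \<psi> (shift v i t z)) has_vector_derivative
      c * pderiv_dir v i \<phi> z + d * pderiv_dir v i \<psi> z) (at 0)" if "v \<in> directions" for v i z
    by (intro derivative_intros pderiv_dir_0 assms that)
  show "has_pderivs (\<lambda>z. c * \<phi> z + d * \<psi> z)"
    by (rule has_pderivsI) (use * in blast)
  show "v \<in> directions \<Longrightarrow> pderiv_dir v i (\<lambda>z. c * \<phi> z + d * \<psi> z) z =
      c * pderiv_dir v i \<phi> z + d * pderiv_dir v i \<psi> z"
    by (rule pderiv_dirI) (rule *)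
qed

text \<open>The first factor enters with an explicit derivative, so that
  \<open>cnj_coord_has_vector_derivative\<close> can be plugged in directly for multiplication by a
  conjugate coordinate.\<close>

lemma pderiv_dir_mult:
  assumes "\<And>v i z. v \<in> directions \<Longrightarrow>
      ((\<lambda>t. \<phi> (shift v i t z)) has_vector_derivative d\<phi> v i z) (at 0)"
    and "has_pderivs \<psi>"
  shows "has_pderivs (\<lambda>z. \<phi> z * \<psi> z)"
    and "v \<in> directions \<Longrightarrow> pderiv_dir v i (\<lambda>z. \<phi> z * \<psi> z) z =
      \<phi> z * pderiv_dir v i \<psi> z + d\<phi> v i z * \<psi> z"
proof -
  have *: "((\<lambda>t. \<phi> (shift v i t z) * \<psi> (shift v i t z)) has_vector_derivative
      \<phi> z * pderiv_dir v i \<psi> z + d\<phi> v i z * \<psi> z) (at 0)" if "v \<in> directions" for v i z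
    using has_vector_derivative_mult[OF assms(1)[OF that] pderiv_dir_0[OF assms(2) that]] by simp
  show "has_pderivs (\<lambda>z. \<phi> z * \<psi> z)"
    by (rule has_pderivsI) (use * in blast)
  show "v \<in> directions \<Longrightarrow> pderiv_dir v i (\<lambda>z. \<phi> z * \<psi> z) z =
      \<phi> z * pderiv_dir v i \<psi> z + d\<phi> v i z * \<psi> z"
    by (rule pderiv_dirI) (rule *)
qed

lemma cnj_coord_has_vector_derivative:
  "((\<lambda>t. cnj (shift v i t z k)) has_vector_derivative (if i = k then cnj v else 0)) (at 0)"
  by (auto simp: shift_def intro!: derivative_eq_intros)

text \<open>Differentiate \<open>\<phi> = \<phi>(-1) + \<integral> D\<^sub>w \<phi>\<close> under the integral sign in direction \<open>v\<close>, then apply the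
  fundamental theorem of calculus in direction \<open>w\<close>.\<close>

lemma pderiv_dir_commute:
  assumes \<phi>: "has_pderivs \<phi>" "has_pderivs (pderiv_dir w j \<phi>)"
    and cont: "continuous_on UNIV (pderiv_dir w j \<phi>)"
      "continuous_on UNIV (pderiv_dir v i (pderiv_dir w j \<phi>))"
    and vw: "v \<in> directions" "w \<in> directions"
  shows "pderiv_dir w j (pderiv_dir v i \<phi>) z = pderiv_dir v i (pderiv_dir w j \<phi>) z"
proof -
  define D where "D = pderiv_dir w j \<phi>"
  define D' where "D' = pderiv_dir v i D"
  have contD: "continuous_on A (\<lambda>x. D (shift v i (f x) (shift w j (g x) z)))"
    if "continuous_on A f" "continuous_on A g" for A :: "'a::topological_space set" and f g
    unfolding D_def
    by (rule continuous_on_compose2[OF cont(1)]) (use that in \<open>auto intro!: continuous_on_shift\<close>)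
  have contD': "continuous_on A (\<lambda>x. D' (shift v i (f x) (shift w j (g x) z)))"
    if "continuous_on A f" "continuous_on A g" for A :: "'a::topological_space set" and f g
    unfolding D_def D'_def
    by (rule continuous_on_compose2[OF cont(2)]) (use that in \<open>auto intro!: continuous_on_shift\<close>)
  \<comment> \<open>The lower limit -1 keeps 0 in the interior of the interval; at the end the
    derivative within \<open>{-1..1}\<close> is thereby a two-sided derivative at 0.\<close>
  have ftc: "\<phi> (shift v i s (shift w j t z)) =
      \<phi> (shift v i s (shift w j (-1) z)) + integral {-1..t} (\<lambda>\<tau>. D (shift v i s (shift w j \<tau> z)))"
    if "-1 \<le> t" for s t
  proof -
    have "((\<lambda>\<tau>. D (shift v i s (shift w j \<tau> z))) has_integral
        \<phi> (shift w j t (shift v i s z)) - \<phi> (shift w j (-1) (shift v i s z))) {-1..t}"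
    proof (rule fundamental_theorem_of_calculus[OF that])
      fix \<tau> :: real
      show "((\<lambda>\<tau>. \<phi> (shift w j \<tau> (shift v i s z))) has_vector_derivative
          D (shift v i s (shift w j \<tau> z))) (at \<tau> within {-1..t})"
        unfolding D_def shift_commute[of v i s w j]
        by (rule has_vector_derivative_at_within, rule has_vector_derivative_shift[OF \<phi>(1) vw(2)])
    qed
    then show ?thesis
      by (simp add: integral_unique shift_commute[of v i s w j])
  qed
  have pd: "pderiv_dir v i \<phi> (shift w j t z) =
      pderiv_dir v i \<phi> (shift w j (-1) z) + integral {-1..t} (\<lambda>\<tau>. D' (shift w j \<tau> z))"
    if "-1 \<le> t" for t
  proof (rule pderiv_dirI)
    have "((\<lambda>s. integral (cbox (-1) t) (\<lambda>\<tau>. D (shift v i s (shift w j \<tau> z)))) has_vector_derivative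
        integral (cbox (-1) t) (\<lambda>\<tau>. D' (shift v i 0 (shift w j \<tau> z)))) (at 0 within UNIV)"
    proof (rule leibniz_rule_vector_derivative)
      show "((\<lambda>s. D (shift v i s (shift w j \<tau> z))) has_vector_derivative
          D' (shift v i s (shift w j \<tau> z))) (at s within UNIV)" for s \<tau>
        unfolding D'_def
        by (rule has_vector_derivative_shift) (use \<phi> vw in \<open>auto simp: D_def\<close>)
      show "(\<lambda>\<tau>. D (shift v i s (shift w j \<tau> z))) integrable_on cbox (-1) t" for s
        by (intro integrable_continuous contD continuous_intros)
      show "continuous_on (UNIV \<times> cbox (-1) t) (\<lambda>(s, \<tau>). D' (shift v i s (shift w j \<tau> z)))"
        unfolding case_prod_beta by (intro contD' continuous_intros)
    qed auto
    then show "((\<lambda>s. \<phi> (shift v i s (shift w j t z))) has_vector_derivative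
        pderiv_dir v i \<phi> (shift w j (-1) z) + integral {-1..t} (\<lambda>\<tau>. D' (shift w j \<tau> z))) (at 0)"
      unfolding ftc[OF that]
      by (intro has_vector_derivative_add pderiv_dir_0 \<phi> vw) simp
  qed
  have "((\<lambda>t. integral {-1..t} (\<lambda>\<tau>. D' (shift w j \<tau> z))) has_vector_derivative
      D' (shift w j 0 z)) (at 0 within {-1..1})"
    by (rule integral_has_vector_derivative)
      (use contD'[of "{-1..1::real}" "\<lambda>_. 0" "\<lambda>x. x"] in \<open>auto simp: continuous_on_id\<close>)
  then have "((\<lambda>t. pderiv_dir v i \<phi> (shift w j (-1) z) + integral {-1..t} (\<lambda>\<tau>. D' (shift w j \<tau> z)))
      has_vector_derivative 0 + D' z) (at 0 within {-1..1})"
    by (intro has_vector_derivative_add) (auto intro!: derivative_intros)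
  then have int: "((\<lambda>t. pderiv_dir v i \<phi> (shift w j (-1) z) + integral {-1..t} (\<lambda>\<tau>. D' (shift w j \<tau> z)))
      has_vector_derivative D' z) (at 0 within {-1..1})"
    by simp
  have "((\<lambda>t. pderiv_dir v i \<phi> (shift w j t z)) has_vector_derivative D' z) (at 0 within {-1..1})"
    by (rule has_vector_derivative_transform[OF _ _ int]) (auto intro: pd)
  then have "((\<lambda>t. pderiv_dir v i \<phi> (shift w j t z)) has_vector_derivative D' z) (at 0)"
    by (simp add: has_vector_derivative_def at_within_Icc_at)
  then show ?thesis
    unfolding D'_def D_def by (rule pderiv_dirI)
qed

subsection \<open>Tempered functions\<close>

text \<open>The summand 1 keeps the weight at least 1, so its powers increase with the exponent as
  well as with the number of coordinates.\<close>

definition poly_weight :: "nat \<Rightarrow> cseq \<Rightarrow> real" where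
  "poly_weight n z = 1 + (\<Sum>j<n. cmod (z j))"

definition moderate :: "(cseq \<Rightarrow> complex) \<Rightarrow> bool" where
  "moderate \<phi> \<longleftrightarrow> (\<exists>C n p. \<forall>z. cmod (\<phi> z) \<le> C * poly_weight n z ^ p)"

lemma poly_weight_ge_1: "1 \<le> poly_weight n z"
  by (simp add: poly_weight_def sum_nonneg)

lemma poly_weight_mono: "n \<le> m \<Longrightarrow> poly_weight n z \<le> poly_weight m z"
  by (auto simp: poly_weight_def intro!: sum_mono2)

text \<open>A growth bound survives enlarging the number of coordinates and the exponent, so two
  functions can be compared against one common weight. The constant is replaced by its absolute
  value to make it nonnegative.\<close>

lemma moderateE:
  assumes "moderate \<phi>"
  obtains C m q where "0 \<le> C" "\<And>n p z. m \<le> n \<Longrightarrow> q \<le> p \<Longrightarrow> cmod (\<phi> z) \<le> C * poly_weight n z ^ p"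
proof -
  from assms obtain C n p where *: "\<And>z. cmod (\<phi> z) \<le> C * poly_weight n z ^ p"
    unfolding moderate_def by blast
  have "cmod (\<phi> z) \<le> \<bar>C\<bar> * poly_weight n' z ^ p'" if "n \<le> n'" "p \<le> p'" for n' p' z
  proof -
    have "poly_weight n z ^ p \<le> poly_weight n' z ^ p"
      using poly_weight_mono[OF that(1)] poly_weight_ge_1[of n z] by (intro power_mono) auto
    also have "\<dots> \<le> poly_weight n' z ^ p'"
      by (rule power_increasing[OF that(2) poly_weight_ge_1])
    finally have "\<bar>C\<bar> * poly_weight n z ^ p \<le> \<bar>C\<bar> * poly_weight n' z ^ p'"
      by (intro mult_left_mono) auto
    moreover have "C * poly_weight n z ^ p \<le> \<bar>C\<bar> * poly_weight n z ^ p"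
      using poly_weight_ge_1[of n z] by (intro mult_right_mono) auto
    ultimately show ?thesis using *[of z] by linarith
  qed
  then show thesis using that[of "\<bar>C\<bar>" n p] by auto
qed

lemma moderate_lincomb:
  assumes "moderate \<phi>" "moderate \<psi>"
  shows "moderate (\<lambda>z. c * \<phi> z + d * \<psi> z)"
proof -
  from moderateE[OF assms(1)] obtain C m q where
    1: "\<And>n p z. m \<le> n \<Longrightarrow> q \<le> p \<Longrightarrow> cmod (\<phi> z) \<le> C * poly_weight n z ^ p" by metis
  from moderateE[OF assms(2)] obtain C' m' q' where
    2: "\<And>n p z. m' \<le> n \<Longrightarrow> q' \<le> p \<Longrightarrow> cmod (\<psi> z) \<le> C' * poly_weight n z ^ p" by metis
  have "cmod (c * \<phi> z + d * \<psi> z) \<le> (cmod c * C + cmod d * C') * poly_weight (max m m') z ^ max q q'" for z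
  proof -
    have "cmod (c * \<phi> z + d * \<psi> z) \<le> cmod c * cmod (\<phi> z) + cmod d * cmod (\<psi> z)"
      by (metis norm_mult norm_triangle_ineq)
    also have "\<dots> \<le> cmod c * (C * poly_weight (max m m') z ^ max q q') + cmod d * (C' * poly_weight (max m m') z ^ max q q')"
      by (intro add_mono mult_left_mono 1 2) auto
    finally show ?thesis by (simp add: algebra_simps)
  qed
  then show ?thesis unfolding moderate_def by blast
qed

lemma moderate_mult:
  assumes "moderate \<phi>" "moderate \<psi>"
  shows "moderate (\<lambda>z. \<phi> z * \<psi> z)"
proof -
  from moderateE[OF assms(1)] obtain C m q where
    1: "0 \<le> C" "\<And>n p z. m \<le> n \<Longrightarrow> q \<le> p \<Longrightarrow> cmod (\<phi> z) \<le> C * poly_weight n z ^ p" by metis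
  from moderateE[OF assms(2)] obtain C' m' q' where
    2: "0 \<le> C'" "\<And>n p z. m' \<le> n \<Longrightarrow> q' \<le> p \<Longrightarrow> cmod (\<psi> z) \<le> C' * poly_weight n z ^ p" by metis
  have "cmod (\<phi> z * \<psi> z) \<le> (C * C') * poly_weight (max m m') z ^ (q + q')" for z
  proof -
    have "cmod (\<phi> z) * cmod (\<psi> z) \<le> (C * poly_weight (max m m') z ^ q) * (C' * poly_weight (max m m') z ^ q')"
      using poly_weight_ge_1[of "max m m'" z] 1(1) 2(1) by (intro mult_mono 1(2) 2(2)) auto
    then show ?thesis by (simp add: norm_mult power_add algebra_simps)
  qed
  then show ?thesis unfolding moderate_def by blast
qed

lemma moderate_cnj_coord: "moderate (\<lambda>z. cnj (z k))"
proof -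
  have "cmod (cnj (z k)) \<le> 1 * poly_weight (Suc k) z ^ 1" for z
    by (simp add: poly_weight_def sum_nonneg add_increasing)
  then show ?thesis unfolding moderate_def by blast
qed

lemma moderate_norm_le:
  assumes "moderate \<phi>" "\<And>z. cmod (\<psi> z) \<le> cmod (\<phi> z)"
  shows "moderate \<psi>"
  using assms order_trans unfolding moderate_def by metis

text \<open>A greatest fixed point: membership is shown by exhibiting a class closed under a single
  partial derivative. Iterated Leibniz formulas for derivatives of arbitrary order are thereby
  avoided.\<close>

coinductive tempered :: "(cseq \<Rightarrow> complex) \<Rightarrow> bool" where
  tempered: "continuous_on UNIV \<phi> \<Longrightarrow> has_pderivs \<phi> \<Longrightarrow> moderate \<phi> \<Longrightarrow>
    (\<And>v i. v \<in> directions \<Longrightarrow> tempered (pderiv_dir v i \<phi>)) \<Longrightarrow> tempered \<phi>"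

lemma temperedD:
  assumes "tempered \<phi>"
  shows tempered_continuous: "continuous_on UNIV \<phi>"
    and tempered_has_pderivs: "has_pderivs \<phi>"
    and tempered_moderate: "moderate \<phi>"
    and tempered_pderiv_dir: "v \<in> directions \<Longrightarrow> tempered (pderiv_dir v i \<phi>)"
  using assms by (auto elim: tempered.cases)

lemma tempered_coinduct [consumes 1, case_names continuous has_pderivs moderate pderiv_dir]:
  assumes "X \<phi>"
    and "\<And>\<eta>. X \<eta> \<Longrightarrow> continuous_on UNIV \<eta>"
    and "\<And>\<eta>. X \<eta> \<Longrightarrow> has_pderivs \<eta>"
    and "\<And>\<eta>. X \<eta> \<Longrightarrow> moderate \<eta>"
    and "\<And>\<eta> v i. X \<eta> \<Longrightarrow> v \<in> directions \<Longrightarrow> X (pderiv_dir v i \<eta>)"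
  shows "tempered \<phi>"
proof (rule tempered.coinduct[where X = X, OF assms(1)])
  fix \<eta> assume "X \<eta>"
  with assms(2-5) have "continuous_on UNIV \<eta>" "has_pderivs \<eta>" "moderate \<eta>"
    "\<And>v i. v \<in> directions \<Longrightarrow> X (pderiv_dir v i \<eta>)" by blast+
  then show "\<exists>\<phi>'. \<eta> = \<phi>' \<and> continuous_on UNIV \<phi>' \<and> has_pderivs \<phi>' \<and> moderate \<phi>' \<and>
      (\<forall>v i. v \<in> directions \<longrightarrow> X (pderiv_dir v i \<phi>') \<or> tempered (pderiv_dir v i \<phi>'))"
    by (intro exI[of _ \<eta>]) auto
qed

lemma continuous_on_coord: "continuous_on UNIV (\<lambda>z::cseq. z k)"
  by (rule continuous_on_product_coordinates)

lemma tempered_lincomb: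
  assumes "tempered \<phi>" "tempered \<psi>"
  shows "tempered (\<lambda>z. c * \<phi> z + d * \<psi> z)"
proof -
  define X where "X \<eta> \<longleftrightarrow> (\<exists>A B. \<eta> = (\<lambda>z. c * A z + d * B z) \<and> tempered A \<and> tempered B)" for \<eta>
  have "X (\<lambda>z. c * \<phi> z + d * \<psi> z)" using assms unfolding X_def by blast
  then show ?thesis
  proof (cases rule: tempered_coinduct[where X = X])
    case (pderiv_dir \<eta> v i)
    then obtain A B where \<eta>: "\<eta> = (\<lambda>z. c * A z + d * B z)" and AB: "tempered A" "tempered B"
      unfolding X_def by blast
    have "pderiv_dir v i \<eta> = (\<lambda>z. c * pderiv_dir v i A z + d * pderiv_dir v i B z)"
      unfolding \<eta> using pderiv_dir_lincomb(2)[OF AB[THEN tempered_has_pderivs] pderiv_dir(2)] by blast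
    then show ?case
      unfolding X_def using AB[THEN tempered_pderiv_dir[OF _ pderiv_dir(2)]] by blast
  qed (auto simp: X_def intro!: continuous_intros intro: tempered_continuous tempered_moderate
      tempered_has_pderivs moderate_lincomb pderiv_dir_lincomb)
qed

lemma tempered_cmult: "tempered \<phi> \<Longrightarrow> tempered (\<lambda>z. c * \<phi> z)"
  using tempered_lincomb[of \<phi> \<phi> c 0] by simp

lemma tempered_add: "tempered \<phi> \<Longrightarrow> tempered \<psi> \<Longrightarrow> tempered (\<lambda>z. \<phi> z + \<psi> z)"
  using tempered_lincomb[of \<phi> \<psi> 1 1] by simp

lemma tempered_0: "tempered (\<lambda>z. 0)"
proof -
  have "(\<lambda>z. 0 :: complex) = (\<lambda>z :: cseq. 0)" ..
  then show ?thesis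
  proof (rule tempered_coinduct[where X = "\<lambda>\<eta>. \<eta> = (\<lambda>z. 0)"])
    show "moderate \<eta>" if "\<eta> = (\<lambda>z. 0)" for \<eta>
      unfolding that moderate_def by (auto intro!: exI[of _ 0])
  qed (auto simp: has_pderivs_def pderiv_dir_def fun_eq_iff)
qed

lemma tempered_sum: "(\<And>i. i \<in> A \<Longrightarrow> tempered (f i)) \<Longrightarrow> tempered (\<lambda>z. \<Sum>i\<in>A. f i z)"
  by (induction A rule: infinite_finite_induct) (auto intro: tempered_0 tempered_add)

lemma tempered_cnj_coord_mult:
  assumes "tempered \<phi>"
  shows "tempered (\<lambda>z. cnj (z k) * \<phi> z)"
proof -
  \<comment> \<open>The summand \<open>B\<close> is needed for closure: differentiating
    \<open>cnj (z k) * A z\<close> in coordinate k leaves a constant multiple of \<open>A\<close>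
    besides the product.\<close>
  define X where "X \<eta> \<longleftrightarrow> (\<exists>A B. \<eta> = (\<lambda>z. cnj (z k) * A z + B z) \<and> tempered A \<and> tempered B)" for \<eta>
  have mult: "has_pderivs (\<lambda>z. cnj (z k) * A z)"
    "v \<in> directions \<Longrightarrow> pderiv_dir v i (\<lambda>z. cnj (z k) * A z) z =
      cnj (z k) * pderiv_dir v i A z + (if i = k then cnj v else 0) * A z"
    if "tempered A" for A v i z
    using pderiv_dir_mult[OF cnj_coord_has_vector_derivative tempered_has_pderivs[OF that]] by blast+
  have "X (\<lambda>z. cnj (z k) * \<phi> z)"
    unfolding X_def using assms tempered_0 by (intro exI[of _ \<phi>] exI[of _ "\<lambda>z. 0"]) auto
  then show ?thesis
  proof (cases rule: tempered_coinduct[where X = X])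
    case (pderiv_dir \<eta> v i)
    then obtain A B where \<eta>: "\<eta> = (\<lambda>z. cnj (z k) * A z + B z)" and AB: "tempered A" "tempered B"
      unfolding X_def by blast
    have "pderiv_dir v i \<eta> = (\<lambda>z. cnj (z k) * pderiv_dir v i A z +
        ((if i = k then cnj v else 0) * A z + 1 * pderiv_dir v i B z))"
      unfolding \<eta>
      using pderiv_dir_lincomb(2)[OF mult(1)[OF AB(1)] tempered_has_pderivs[OF AB(2)] pderiv_dir(2), of i 1 1]
        mult(2)[OF AB(1) pderiv_dir(2), of i]
      by (simp add: fun_eq_iff)
    moreover have "tempered (pderiv_dir v i A)"
      "tempered (\<lambda>z. (if i = k then cnj v else 0) * A z + 1 * pderiv_dir v i B z)"
      using AB pderiv_dir(2) by (blast intro: tempered_pderiv_dir tempered_lincomb)+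
    ultimately show ?case
      unfolding X_def
      by (intro exI[of _ "pderiv_dir v i A"] conjI
          exI[of _ "\<lambda>z. (if i = k then cnj v else 0) * A z + 1 * pderiv_dir v i B z"])
  next
    case (moderate \<eta>)
    then obtain A B where \<eta>: "\<eta> = (\<lambda>z. cnj (z k) * A z + B z)" and AB: "tempered A" "tempered B"
      unfolding X_def by blast
    show ?case unfolding \<eta>
      using moderate_lincomb[OF moderate_mult[OF moderate_cnj_coord tempered_moderate] tempered_moderate, OF AB, of 1 k 1]
      by simp
  next
    case (has_pderivs \<eta>)
    then obtain A B where \<eta>: "\<eta> = (\<lambda>z. cnj (z k) * A z + B z)" and AB: "tempered A" "tempered B"
      unfolding X_def by blast
    show ?case unfolding \<eta>
      using pderiv_dir_lincomb(1)[OF mult(1)[OF AB(1)] tempered_has_pderivs[OF AB(2)], of 1 1] by simp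
  next
    case (continuous \<eta>)
    then show ?case unfolding X_def
      using continuous_on_coord by (auto intro!: continuous_intros dest: tempered_continuous)
  qed
qed

section \<open>Smooth compactly supported cylinder functions are tempered\<close>

lemma smoothD:
  assumes "smooth \<phi>"
  shows smooth_continuous: "continuous_on UNIV \<phi>"
    and smooth_has_pderivs: "has_pderivs \<phi>"
    and smooth_pderiv_dir: "v \<in> directions \<Longrightarrow> smooth (pderiv_dir v i \<phi>)"
proof -
  show "continuous_on UNIV \<phi>" "has_pderivs \<phi>"
    using assms[unfolded smooth_def, rule_format, of "[]"] by (auto simp: iter_pderiv_def)
  assume v: "v \<in> directions"
  show "smooth (pderiv_dir v i \<phi>)"
    unfolding smooth_def
  proof (intro allI impI)
    fix ds assume "set ds \<subseteq> directions \<times> (UNIV :: nat set)"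
    then show "continuous_on UNIV (iter_pderiv ds (pderiv_dir v i \<phi>)) \<and>
        has_pderivs (iter_pderiv ds (pderiv_dir v i \<phi>))"
      using assms[unfolded smooth_def, rule_format, of "ds @ [(v, i)]"] v by (auto simp: iter_pderiv_def)
  qed
qed

definition depends_on :: "nat \<Rightarrow> (cseq \<Rightarrow> complex) \<Rightarrow> bool" where
  "depends_on n \<phi> \<longleftrightarrow> (\<forall>z w. (\<forall>i<n. z i = w i) \<longrightarrow> \<phi> z = \<phi> w)"

lemma depends_on_mono: "depends_on n \<phi> \<Longrightarrow> n \<le> m \<Longrightarrow> depends_on m \<phi>"
  unfolding depends_on_def by (meson less_le_trans)

lemma depends_on_pderiv_dir: "depends_on n \<phi> \<Longrightarrow> depends_on n (pderiv_dir v i \<phi>)"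
  unfolding depends_on_def pderiv_dir_shift
proof (intro allI impI)
  fix z w :: cseq
  assume *: "\<forall>z w. (\<forall>i<n. z i = w i) \<longrightarrow> \<phi> z = \<phi> w" and zw: "\<forall>i<n. z i = w i"
  have "(\<lambda>t. \<phi> (shift v i t z)) = (\<lambda>t. \<phi> (shift v i t w))"
    using zw by (intro ext *[rule_format]) (simp add: shift_def)
  then show "vector_derivative (\<lambda>t. \<phi> (shift v i t z)) (at 0) = vector_derivative (\<lambda>t. \<phi> (shift v i t w)) (at 0)"
    by simp
qed

lemma pderiv_dir_eq_0: "depends_on n \<phi> \<Longrightarrow> n \<le> i \<Longrightarrow> pderiv_dir v i \<phi> z = 0"
proof (rule pderiv_dirI)
  assume *: "depends_on n \<phi>" "n \<le> i"
  have "(\<lambda>t. \<phi> (shift v i t z)) = (\<lambda>t. \<phi> z)"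
    using *(2) by (intro ext *(1)[unfolded depends_on_def, rule_format]) (auto simp: shift_def)
  then show "((\<lambda>t. \<phi> (shift v i t z)) has_vector_derivative 0) (at 0)"
    by simp
qed

lemma Cc_smoothE:
  assumes "\<phi> \<in> Cc_smooth"
  obtains n R where "smooth \<phi>" "depends_on n \<phi>" "0 < n" "\<And>z i. i < n \<Longrightarrow> R < cmod (z i) \<Longrightarrow> \<phi> z = 0"
  using assms unfolding Cc_smooth_def depends_on_def mem_Collect_eq by blast

text \<open>The condition \<open>R < cmod (z k)\<close> is strict, hence stable under small shifts.
  The function vanishes along the whole short segment, so its derivative vanishes too and the same n
  and R serve for the derivative.\<close>

lemma Cc_smooth_pderiv_dir:
  assumes "\<phi> \<in> Cc_smooth" "v \<in> directions"
  shows "pderiv_dir v i \<phi> \<in> Cc_smooth"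
proof -
  from Cc_smoothE[OF assms(1)] obtain n R where n: "smooth \<phi>" "depends_on n \<phi>" "0 < n"
      and R: "\<And>z i. i < n \<Longrightarrow> R < cmod (z i) \<Longrightarrow> \<phi> z = 0"
    by metis
  have "pderiv_dir v i \<phi> z = 0" if "\<exists>k<n. R < cmod (z k)" for z
  proof (rule pderiv_dirI)
    from that obtain k where k: "k < n" "R < cmod (z k)" by blast
    have "((\<lambda>t. cmod (shift v i t z k)) \<longlongrightarrow> cmod (shift v i 0 z k)) (at 0)"
      by (cases "k = i") (auto simp: shift_def intro!: tendsto_eq_intros)
    then have "\<forall>\<^sub>F t in at 0. R < cmod (shift v i t z k)"
      using k(2) by (intro order_tendstoD(1)) (auto simp: shift_def)
    then have "\<forall>\<^sub>F t in at 0. \<phi> (shift v i t z) = 0"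
      by eventually_elim (use k R in blast)
    moreover have "\<phi> (shift v i 0 z) = 0" using R k by auto
    ultimately show "((\<lambda>t. \<phi> (shift v i t z)) has_vector_derivative 0) (at 0)"
      using has_vector_derivative_const[of 0 "at 0"]
      by (subst has_vector_derivative_cong_ev[where g = "\<lambda>_. 0"]) (auto simp: eventually_nhds_conv_at)
  qed
  then show ?thesis
    using n smooth_pderiv_dir[OF n(1) assms(2)] depends_on_pderiv_dir[OF n(2), of v i]
    unfolding Cc_smooth_def depends_on_def by blast
qed

text \<open>Such a function is even bounded: the infinite product of closed balls is compact by
  Tychonoff, and every point at which the function may be nonzero can be moved into it without
  changing the value.\<close>

lemma Cc_smooth_moderate:
  assumes "\<phi> \<in> Cc_smooth"
  shows "moderate \<phi>"
proof -
  from Cc_smoothE[OF assms] obtain n R where n: "smooth \<phi>" "depends_on n \<phi>" "0 < n"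
      and R: "\<And>z i. i < n \<Longrightarrow> R < cmod (z i) \<Longrightarrow> \<phi> z = 0"
    by metis
  define K where "K = (PiE UNIV (\<lambda>i. cball 0 R) :: cseq set)"
  have "compactin (product_topology (\<lambda>i. euclidean) UNIV) K"
    unfolding K_def by (simp add: compactin_PiE)
  then have "compact K"
    by (simp add: euclidean_product_topology)
  then have "bounded (\<phi> ` K)"
    using smooth_continuous[OF n(1)] by (meson compact_continuous_image compact_imp_bounded continuous_on_subset subset_UNIV)
  then obtain B where B: "\<And>z. z \<in> K \<Longrightarrow> cmod (\<phi> z) \<le> B"
    unfolding bounded_iff by blast
  have "cmod (\<phi> z) \<le> \<bar>B\<bar> * poly_weight 0 z ^ 0" for z
  proof (cases "\<exists>i<n. R < cmod (z i)")
    case False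
    \<comment> \<open>The coordinates from n on may be arbitrarily large and are overwritten. The
      filler \<open>z 0\<close> lies in the ball because \<open>0 < n\<close>, so the sign of R need
      not be discussed.\<close>
    define w where "w i = (if i < n then z i else z 0)" for i
    have "cmod (z i) \<le> R" if "i < n" for i using False that by force
    then have "w \<in> K" using n(3) by (auto simp: K_def w_def)
    moreover have "\<phi> z = \<phi> w"
      using n(2) by (simp add: depends_on_def w_def)
    ultimately show ?thesis using B[of w] by simp
  qed (use R in auto)
  then show ?thesis unfolding moderate_def by blast
qed

lemma Cc_smooth_smooth: "\<phi> \<in> Cc_smooth \<Longrightarrow> smooth \<phi>"
  by (simp add: Cc_smooth_def)

lemma Cc_smooth_tempered: "\<phi> \<in> Cc_smooth \<Longrightarrow> tempered \<phi>"
  by (rule tempered_coinduct[where X = "\<lambda>\<phi>. \<phi> \<in> Cc_smooth"])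
    (blast intro: smooth_continuous smooth_has_pderivs Cc_smooth_smooth Cc_smooth_moderate
      Cc_smooth_pderiv_dir)+

subsection \<open>Integration by parts for Gaussian measures\<close>

lemma add_power_le:
  fixes x y :: real
  assumes "0 \<le> x" "0 \<le> y"
  shows "(x + y) ^ p \<le> 2 ^ p * (x ^ p + y ^ p)"
proof -
  have "(x + y) ^ p \<le> (2 * max x y) ^ p"
    using assms by (intro power_mono) auto
  also have "\<dots> = 2 ^ p * max x y ^ p"
    by (simp add: power_mult_distrib)
  also have "max x y ^ p \<le> x ^ p + y ^ p"
    using assms by (auto simp: max_def)
  finally show ?thesis by simp
qed

lemma prob_space_gaussian: "0 < \<sigma> \<Longrightarrow> prob_space (gaussian \<sigma>)"
  unfolding gaussian_def by (rule prob_space_normal_density)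

lemma sets_gaussian [simp, measurable_cong]: "sets (gaussian \<sigma>) = sets borel"
  by (simp add: gaussian_def)

lemma space_gaussian [simp]: "space (gaussian \<sigma>) = UNIV"
  by (simp add: gaussian_def)

lemma integrable_gaussian_iff:
  fixes f :: "real \<Rightarrow> 'a::{banach, second_countable_topology}"
  assumes "0 < \<sigma>" "f \<in> borel_measurable borel"
  shows "integrable (gaussian \<sigma>) f \<longleftrightarrow> integrable lborel (\<lambda>x. normal_density 0 \<sigma> x *\<^sub>R f x)"
  unfolding gaussian_def
  by (rule integrable_density) (use assms in \<open>auto simp: normal_density_nonneg\<close>)

lemma integral_gaussian:
  fixes f :: "real \<Rightarrow> 'a::{banach, second_countable_topology}"
  assumes "0 < \<sigma>" "f \<in> borel_measurable borel"
  shows "(\<integral>x. f x \<partial>gaussian \<sigma>) = (\<integral>x. normal_density 0 \<sigma> x *\<^sub>R f x \<partial>lborel)"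
  unfolding gaussian_def
  by (rule integral_density) (use assms in \<open>auto simp: normal_density_nonneg\<close>)

lemma integrable_gaussian_moment:
  assumes "0 < \<sigma>"
  shows "integrable (gaussian \<sigma>) (\<lambda>x. (1 + \<bar>x\<bar>) ^ p)"
proof -
  interpret prob_space "gaussian \<sigma>" by (rule prob_space_gaussian[OF assms])
  have "integrable (gaussian \<sigma>) (\<lambda>x. \<bar>x\<bar> ^ p)"
    using assms integrable_normal_moment_abs[OF assms, of 0 p] by (simp add: integrable_gaussian_iff)
  then have *: "integrable (gaussian \<sigma>) (\<lambda>x. 2 ^ p * (1 ^ p + \<bar>x\<bar> ^ p))"
    by simp
  show ?thesis
    by (rule Bochner_Integration.integrable_bound[OF *]) (use add_power_le[of 1 "\<bar>x\<bar>" p for x] in \<open>auto intro!: AE_I2\<close>)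
qed

lemma integrable_gaussian_poly:
  fixes f :: "real \<Rightarrow> complex"
  assumes "0 < \<sigma>" "f \<in> borel_measurable borel" "\<And>x. cmod (f x) \<le> C * (1 + \<bar>x\<bar>) ^ p"
  shows "integrable (gaussian \<sigma>) f"
proof (rule Bochner_Integration.integrable_bound)
  show "integrable (gaussian \<sigma>) (\<lambda>x. C * (1 + \<bar>x\<bar>) ^ p)"
    using integrable_gaussian_moment[OF assms(1)] by simp
  show "AE x in gaussian \<sigma>. norm (f x) \<le> norm (C * (1 + \<bar>x\<bar>) ^ p)"
    using assms(3) by (auto intro!: AE_I2 order_trans[OF assms(3)])
qed (use assms in simp)

lemma normal_density_poly_tendsto:
  assumes "0 < \<sigma>"
  shows "((\<lambda>x. (1 + \<bar>x\<bar>) ^ p * normal_density 0 \<sigma> x) \<longlongrightarrow> 0) at_top"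
    and "((\<lambda>x. (1 + \<bar>x\<bar>) ^ p * normal_density 0 \<sigma> x) \<longlongrightarrow> 0) at_bot"
  unfolding normal_density_def using assms by real_asymp+

lemma normal_density_has_derivative:
  assumes "0 < \<sigma>"
  shows "(normal_density 0 \<sigma> has_real_derivative - (x / \<sigma>\<^sup>2) * normal_density 0 \<sigma> x) (at x)"
  unfolding normal_density_def using assms
  by (auto intro!: derivative_eq_intros simp: field_simps)

text \<open>The density \<rho> satisfies \<rho>' = -(x / \<sigma>^2) \<rho>, so the difference of
  the two integrands times \<rho> is the derivative of \<rho> f. That derivative is integrable, and
  \<rho> f vanishes at both ends because Gaussian decay beats polynomial growth.\<close>

lemma gaussian_integration_by_parts:
  fixes f f' :: "real \<Rightarrow> complex"
  assumes \<sigma>: "0 < \<sigma>"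
    and f: "\<And>x. (f has_vector_derivative f' x) (at x)" and cont: "continuous_on UNIV f'"
    and bound: "\<And>x. cmod (f x) \<le> C * (1 + \<bar>x\<bar>) ^ p" "\<And>x. cmod (f' x) \<le> C * (1 + \<bar>x\<bar>) ^ p"
  shows "(\<integral>x. f' x \<partial>gaussian \<sigma>) = (\<integral>x. complex_of_real (x / \<sigma>\<^sup>2) * f x \<partial>gaussian \<sigma>)"
proof -
  let ?\<rho> = "normal_density 0 \<sigma>"
  have contf: "continuous_on UNIV f"
    using f by (meson continuous_at_imp_continuous_on has_vector_derivative_continuous)
  have [measurable]: "f \<in> borel_measurable borel" "f' \<in> borel_measurable borel"
    using cont contf by (auto intro: borel_measurable_continuous_onI)
  have C: "0 \<le> C" using order_trans[OF norm_ge_zero bound(1)[of 0]] by simp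
  have int1: "integrable (gaussian \<sigma>) f'"
    by (rule integrable_gaussian_poly[OF \<sigma> _ bound(2)]) simp
  have int2: "integrable (gaussian \<sigma>) (\<lambda>x. complex_of_real (x / \<sigma>\<^sup>2) * f x)"
  proof (rule integrable_gaussian_poly[OF \<sigma>])
    fix x :: real
    have "cmod (complex_of_real (x / \<sigma>\<^sup>2) * f x) = \<bar>x\<bar> / \<sigma>\<^sup>2 * cmod (f x)"
      by (simp add: norm_mult norm_divide norm_power)
    also have "\<dots> \<le> (1 + \<bar>x\<bar>) / \<sigma>\<^sup>2 * (C * (1 + \<bar>x\<bar>) ^ p)"
      by (intro mult_mono bound divide_right_mono) auto
    finally show "cmod (complex_of_real (x / \<sigma>\<^sup>2) * f x) \<le> C / \<sigma>\<^sup>2 * (1 + \<bar>x\<bar>) ^ Suc p"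
      by (simp add: field_simps)
  qed simp
  define g where "g x = ?\<rho> x *\<^sub>R f' x + (- (x / \<sigma>\<^sup>2) * ?\<rho> x) *\<^sub>R f x" for x
  have g: "((\<lambda>x. ?\<rho> x *\<^sub>R f x) has_vector_derivative g x) (at x)" for x
    unfolding g_def using has_vector_derivative_scaleR[OF normal_density_has_derivative[OF \<sigma>] f] .
  have int_g: "integrable lborel g"
    using Bochner_Integration.integrable_diff[OF iffD1[OF integrable_gaussian_iff[OF \<sigma>] int1] iffD1[OF integrable_gaussian_iff[OF \<sigma>] int2]]
    by (simp add: g_def[abs_def] scaleR_conv_of_real algebra_simps)
  have lim: "((\<lambda>x. ?\<rho> x *\<^sub>R f x) \<longlongrightarrow> 0) F"
    if "((\<lambda>x. (1 + \<bar>x\<bar>) ^ p * ?\<rho> x) \<longlongrightarrow> 0) F" for F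
  proof (rule tendsto_0_le[OF that, where K = C], rule always_eventually, rule allI)
    fix x
    have "?\<rho> x * cmod (f x) \<le> ?\<rho> x * (C * (1 + \<bar>x\<bar>) ^ p)"
      by (intro mult_left_mono bound) simp
    then show "norm (?\<rho> x *\<^sub>R f x) \<le> norm ((1 + \<bar>x\<bar>) ^ p * ?\<rho> x) * C"
      by (simp add: abs_mult ac_simps)
  qed
  have contg: "isCont g x" for x
  proof -
    have "continuous_on UNIV ?\<rho>" unfolding normal_density_def using \<sigma> by (intro continuous_intros) auto
    then have "continuous_on UNIV g"
      unfolding g_def[abs_def] using contf cont \<sigma> by (intro continuous_intros) auto
    then show ?thesis by (simp add: continuous_on_eq_continuous_at)
  qed
  have "(LBINT x=-\<infinity>..\<infinity>. g x) = 0 - 0"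
  proof (rule interval_integral_FTC_integrable[where F = "\<lambda>x. ?\<rho> x *\<^sub>R f x"])
    show "set_integrable lborel (einterval (-\<infinity>) \<infinity>) g"
      using int_g by (simp add: set_integrable_def)
    show "(((\<lambda>x. ?\<rho> x *\<^sub>R f x) \<circ> real_of_ereal) \<longlongrightarrow> 0) (at_right (-\<infinity>))"
      using lim[OF normal_density_poly_tendsto(2)[OF \<sigma>]] by (simp add: ereal_tendsto_simps1)
    show "(((\<lambda>x. ?\<rho> x *\<^sub>R f x) \<circ> real_of_ereal) \<longlongrightarrow> 0) (at_left \<infinity>)"
      using lim[OF normal_density_poly_tendsto(1)[OF \<sigma>]] by (simp add: ereal_tendsto_simps1)
  qed (use g contg in auto)
  then have "(\<integral>x. g x \<partial>lborel) = 0"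
    by (simp add: interval_lebesgue_integral_def set_lebesgue_integral_def)
  also have "(\<integral>x. g x \<partial>lborel) =
      (\<integral>x. ?\<rho> x *\<^sub>R f' x - ?\<rho> x *\<^sub>R (complex_of_real (x / \<sigma>\<^sup>2) * f x) \<partial>lborel)"
    by (rule Bochner_Integration.integral_cong) (simp_all add: g_def scaleR_conv_of_real)
  also have "\<dots> = (\<integral>x. ?\<rho> x *\<^sub>R f' x \<partial>lborel) - (\<integral>x. ?\<rho> x *\<^sub>R (complex_of_real (x / \<sigma>\<^sup>2) * f x) \<partial>lborel)"
    using int1 int2 \<sigma> by (intro Bochner_Integration.integral_diff) (simp_all add: integrable_gaussian_iff)
  also have "\<dots> = (\<integral>x. f' x \<partial>gaussian \<sigma>) - (\<integral>x. complex_of_real (x / \<sigma>\<^sup>2) * f x \<partial>gaussian \<sigma>)"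
    by (subst (1 2) integral_gaussian[OF \<sigma>]) simp_all
  finally show ?thesis by simp
qed

section \<open>The Gaussian measure on the complex plane\<close>

lemma measurable_Complex [measurable]:
  "(\<lambda>(x, y). Complex x y) \<in> borel_measurable (borel \<Otimes>\<^sub>M borel)"
proof -
  have "(\<lambda>p. complex_of_real (fst p) + \<i> * complex_of_real (snd p)) \<in> borel_measurable (borel \<Otimes>\<^sub>M borel)"
    by measurable
  then show ?thesis by (simp add: Complex_eq case_prod_beta)
qed

lemma measurable_Complex_gaussian [measurable]:
  "(\<lambda>(x, y). Complex x y) \<in> borel_measurable (gaussian \<sigma> \<Otimes>\<^sub>M gaussian \<tau>)"
  using measurable_Complex by (simp cong: measurable_cong_sets add: sets_pair_measure_cong[OF sets_gaussian sets_gaussian])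

lemma sets_complex_gaussian [simp, measurable_cong]: "sets (complex_gaussian \<sigma>) = sets borel"
  by (simp add: complex_gaussian_def)

lemma space_complex_gaussian [simp]: "space (complex_gaussian \<sigma>) = UNIV"
  by (simp add: complex_gaussian_def)

lemma prob_space_complex_gaussian:
  assumes "0 < \<sigma>"
  shows "prob_space (complex_gaussian \<sigma>)"
proof -
  interpret g: prob_space "gaussian \<sigma>" by (rule prob_space_gaussian[OF assms])
  interpret gg: pair_prob_space "gaussian \<sigma>" "gaussian \<sigma>" ..
  show ?thesis unfolding complex_gaussian_def by (rule gg.prob_space_distr) simp
qed

text \<open>The inequality 1 + |x| + |y| \<le> (1 + |x|) (1 + |y|) replaces the modulus by a product
  of one-variable factors, so one-dimensional moments control the integral over the plane.\<close>

lemma integrable_gaussian_pair_poly: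
  fixes f :: "complex \<Rightarrow> complex"
  assumes \<sigma>: "0 < \<sigma>" and f: "f \<in> borel_measurable borel"
    and bound: "\<And>w. cmod (f w) \<le> C * (1 + cmod w) ^ p"
  shows "integrable (gaussian \<sigma> \<Otimes>\<^sub>M gaussian \<sigma>) (\<lambda>(x, y). f (Complex x y))"
proof -
  interpret g: prob_space "gaussian \<sigma>" by (rule prob_space_gaussian[OF \<sigma>])
  interpret gg: pair_prob_space "gaussian \<sigma>" "gaussian \<sigma>" ..
  have C: "0 \<le> C" using order_trans[OF norm_ge_zero bound[of 0]] by simp
  note mom = integrable_gaussian_moment[OF \<sigma>, of p]
  have *: "integrable (gaussian \<sigma> \<Otimes>\<^sub>M gaussian \<sigma>) (\<lambda>q. C * ((1 + \<bar>fst q\<bar>) ^ p * (1 + \<bar>snd q\<bar>) ^ p))"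
  proof (rule gg.Fubini_integrable)
    have "integrable (gaussian \<sigma>) (\<lambda>x. (C * (1 + \<bar>x\<bar>) ^ p) * (\<integral>y. (1 + \<bar>y\<bar>) ^ p \<partial>gaussian \<sigma>))"
      using mom by (intro integrable_mult_left integrable_mult_right)
    then show "integrable (gaussian \<sigma>) (\<lambda>x. \<integral>y. norm (C * ((1 + \<bar>fst (x, y)\<bar>) ^ p * (1 + \<bar>snd (x, y)\<bar>) ^ p)) \<partial>gaussian \<sigma>)"
      using C by (simp add: abs_mult mult.assoc)
    show "AE x in gaussian \<sigma>. integrable (gaussian \<sigma>) (\<lambda>y. C * ((1 + \<bar>fst (x, y)\<bar>) ^ p * (1 + \<bar>snd (x, y)\<bar>) ^ p))"
      using mom by simp
  qed simp
  show ?thesis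
  proof (rule Bochner_Integration.integrable_bound[OF *])
    show "(\<lambda>(x, y). f (Complex x y)) \<in> borel_measurable (gaussian \<sigma> \<Otimes>\<^sub>M gaussian \<sigma>)"
      using measurable_compose[OF measurable_Complex_gaussian f] by (simp add: case_prod_beta)
    have "cmod (f (Complex x y)) \<le> C * ((1 + \<bar>x\<bar>) ^ p * (1 + \<bar>y\<bar>) ^ p)" for x y
    proof -
      have "cmod (Complex x y) \<le> \<bar>x\<bar> + \<bar>y\<bar>"
        using cmod_le[of "Complex x y"] by simp
      moreover have "1 + (\<bar>x\<bar> + \<bar>y\<bar>) \<le> (1 + \<bar>x\<bar>) * (1 + \<bar>y\<bar>)"
        by (simp add: algebra_simps)
      ultimately have "(1 + cmod (Complex x y)) ^ p \<le> ((1 + \<bar>x\<bar>) * (1 + \<bar>y\<bar>)) ^ p"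
        by (intro power_mono) auto
      then show ?thesis
        using order_trans[OF bound mult_left_mono[OF _ C]] by (simp add: power_mult_distrib)
    qed
    then show "AE q in gaussian \<sigma> \<Otimes>\<^sub>M gaussian \<sigma>. norm (case q of (x, y) \<Rightarrow> f (Complex x y))
        \<le> norm (C * ((1 + \<bar>fst q\<bar>) ^ p * (1 + \<bar>snd q\<bar>) ^ p))"
      using C by (auto intro!: AE_I2 simp: abs_mult)
  qed
qed

lemma integrable_complex_gaussian_poly:
  fixes f :: "complex \<Rightarrow> complex"
  assumes "0 < \<sigma>" "f \<in> borel_measurable borel" "\<And>w. cmod (f w) \<le> C * (1 + cmod w) ^ p"
  shows "integrable (complex_gaussian \<sigma>) f"
  unfolding complex_gaussian_def
  using integrable_gaussian_pair_poly[OF assms] assms(2)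
  by (subst integrable_distr_eq) (simp_all add: case_prod_unfold)

text \<open>\<open>Re (w * cnj v)\<close> is the real part of w for v = 1 and the imaginary part for
  v = \<i>, which puts both directions into one formula. By Fubini the variable of differentiation
  is integrated first; the other is frozen and enters only the constant of the growth bound.\<close>

lemma complex_gaussian_integration_by_parts:
  fixes f f' :: "complex \<Rightarrow> complex"
  assumes \<sigma>: "0 < \<sigma>" and v: "v \<in> directions"
    and f: "\<And>w t. ((\<lambda>t. f (w + t *\<^sub>R v)) has_vector_derivative f' (w + t *\<^sub>R v)) (at t)"
    and cont: "continuous_on UNIV f" "continuous_on UNIV f'"
    and bound: "\<And>w. cmod (f w) \<le> C * (1 + cmod w) ^ p" "\<And>w. cmod (f' w) \<le> C * (1 + cmod w) ^ p"
  shows "(\<integral>w. f' w \<partial>complex_gaussian \<sigma>) =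
    (\<integral>w. complex_of_real (Re (w * cnj v) / \<sigma>\<^sup>2) * f w \<partial>complex_gaussian \<sigma>)"
proof -
  interpret g: prob_space "gaussian \<sigma>" by (rule prob_space_gaussian[OF \<sigma>])
  interpret gg: pair_prob_space "gaussian \<sigma>" "gaussian \<sigma>" ..
  define h where "h w = complex_of_real (Re (w * cnj v) / \<sigma>\<^sup>2) * f w" for w
  have C: "0 \<le> C" using order_trans[OF norm_ge_zero bound(1)[of 0]] by simp
  have [measurable]: "f \<in> borel_measurable borel" "f' \<in> borel_measurable borel"
    using cont by (auto intro: borel_measurable_continuous_onI)
  have conth: "continuous_on UNIV h"
    unfolding h_def using cont \<sigma> by (intro continuous_intros) auto
  have [measurable]: "h \<in> borel_measurable borel"
    using conth by (rule borel_measurable_continuous_onI)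
  have boundh: "cmod (h w) \<le> C / \<sigma>\<^sup>2 * (1 + cmod w) ^ Suc p" for w
  proof -
    have "\<bar>Re (w * cnj v)\<bar> \<le> 1 + cmod w"
      using abs_Re_le_cmod[of "w * cnj v"] v by (auto simp: norm_mult)
    then have "\<bar>Re (w * cnj v)\<bar> / \<sigma>\<^sup>2 * cmod (f w) \<le> (1 + cmod w) / \<sigma>\<^sup>2 * (C * (1 + cmod w) ^ p)"
      by (intro mult_mono bound divide_right_mono) auto
    moreover have "cmod (h w) = \<bar>Re (w * cnj v)\<bar> / \<sigma>\<^sup>2 * cmod (f w)"
      unfolding h_def norm_mult norm_of_real by simp
    ultimately show ?thesis by (simp add: field_simps)
  qed
  have poly: "C * (1 + cmod (Complex x y)) ^ p \<le> (C * (1 + \<bar>y\<bar>) ^ p) * (1 + \<bar>x\<bar>) ^ p" for x y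
  proof -
    have "cmod (Complex x y) \<le> \<bar>x\<bar> + \<bar>y\<bar>"
      using cmod_le[of "Complex x y"] by simp
    moreover have "1 + (\<bar>x\<bar> + \<bar>y\<bar>) \<le> (1 + \<bar>y\<bar>) * (1 + \<bar>x\<bar>)"
      by (simp add: algebra_simps)
    ultimately have "(1 + cmod (Complex x y)) ^ p \<le> ((1 + \<bar>y\<bar>) * (1 + \<bar>x\<bar>)) ^ p"
      by (intro power_mono) auto
    then show ?thesis using C by (simp add: power_mult_distrib mult_left_mono mult.assoc)
  qed
  have poly': "C * (1 + cmod (Complex x y)) ^ p \<le> (C * (1 + \<bar>x\<bar>) ^ p) * (1 + \<bar>y\<bar>) ^ p" for x y
    using poly[of x y] by (simp add: ac_simps)
  have contC: "continuous_on UNIV (\<lambda>x. f' (Complex x y))" "continuous_on UNIV (\<lambda>y. f' (Complex x y))" for x y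
    unfolding Complex_eq by (rule continuous_on_compose2[OF cont(2)]; auto intro!: continuous_intros)+
  have I: "(\<integral>w. k w \<partial>complex_gaussian \<sigma>) = (\<integral>(x, y). k (Complex x y) \<partial>(gaussian \<sigma> \<Otimes>\<^sub>M gaussian \<sigma>))"
    if "k \<in> borel_measurable borel" for k :: "complex \<Rightarrow> complex"
    unfolding complex_gaussian_def using that by (subst integral_distr) (simp_all add: case_prod_unfold)
  note int1 = integrable_gaussian_pair_poly[OF \<sigma> _ bound(2), simplified]
  note int2 = integrable_gaussian_pair_poly[OF \<sigma> _ boundh, simplified]
  from v consider "v = 1" | "v = \<i>" by auto
  then have "(\<integral>(x, y). f' (Complex x y) \<partial>(gaussian \<sigma> \<Otimes>\<^sub>M gaussian \<sigma>)) =
      (\<integral>(x, y). h (Complex x y) \<partial>(gaussian \<sigma> \<Otimes>\<^sub>M gaussian \<sigma>))"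
  proof cases
    case 1
    have "(\<integral>x. f' (Complex x y) \<partial>gaussian \<sigma>) = (\<integral>x. complex_of_real (x / \<sigma>\<^sup>2) * f (Complex x y) \<partial>gaussian \<sigma>)" for y
    proof (rule gaussian_integration_by_parts[OF \<sigma> _ contC(1) order_trans[OF bound(1) poly] order_trans[OF bound(2) poly]])
      show "((\<lambda>x. f (Complex x y)) has_vector_derivative f' (Complex x y)) (at x)" for x
        using f[of "Complex 0 y" x] 1 by (simp add: Complex_eq scaleR_conv_of_real add.commute)
    qed
    then have "(\<integral>x. f' (Complex x y) \<partial>gaussian \<sigma>) = (\<integral>x. h (Complex x y) \<partial>gaussian \<sigma>)" for y
      using 1 by (simp add: h_def)
    then show ?thesis
      using gg.integral_snd[OF int1] gg.integral_snd[OF int2] by simp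
  next
    case 2
    have "(\<integral>y. f' (Complex x y) \<partial>gaussian \<sigma>) = (\<integral>y. complex_of_real (y / \<sigma>\<^sup>2) * f (Complex x y) \<partial>gaussian \<sigma>)" for x
    proof (rule gaussian_integration_by_parts[OF \<sigma> _ contC(2) order_trans[OF bound(1) poly'] order_trans[OF bound(2) poly']])
      show "((\<lambda>y. f (Complex x y)) has_vector_derivative f' (Complex x y)) (at y)" for y
        using f[of "Complex x 0" y] 2 by (simp add: Complex_eq scaleR_conv_of_real mult.commute)
    qed
    then have "(\<integral>y. f' (Complex x y) \<partial>gaussian \<sigma>) = (\<integral>y. h (Complex x y) \<partial>gaussian \<sigma>)" for x
      using 2 by (simp add: h_def)
    then show ?thesis
      using gg.integral_fst'[OF int1] gg.integral_fst'[OF int2] by simp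
  qed
  then show ?thesis
    unfolding h_def[symmetric] by (simp add: I)
qed

definition delbar :: "nat \<Rightarrow> (cseq \<Rightarrow> complex) \<Rightarrow> cseq \<Rightarrow> complex" where
  "delbar i \<phi> z = (pderiv_dir 1 i \<phi> z + \<i> * pderiv_dir \<i> i \<phi> z) / 2"

lemma poly_weight_Suc: "poly_weight (Suc n) z = poly_weight n z + cmod (z n)"
  by (simp add: poly_weight_def)

lemma poly_weight_upd: "poly_weight n (z(i := w)) \<le> poly_weight n z * (1 + cmod w)"
proof -
  have "(\<Sum>j<n. cmod ((z(i := w)) j)) \<le> (\<Sum>j<n. cmod (z j) + (if j = i then cmod w else 0))"
    by (rule sum_mono) auto
  also have "\<dots> \<le> (\<Sum>j<n. cmod (z j)) + cmod w"
    by (simp add: sum.distrib)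
  finally have "poly_weight n (z(i := w)) \<le> poly_weight n z + 1 * cmod w"
    by (simp add: poly_weight_def)
  also have "\<dots> \<le> poly_weight n z + poly_weight n z * cmod w"
    by (intro add_left_mono mult_right_mono poly_weight_ge_1) auto
  finally show ?thesis by (simp add: algebra_simps)
qed

lemma ell2_upd_iff: "z(i := w) \<in> ell2 \<longleftrightarrow> z \<in> ell2"
proof -
  have "\<forall>\<^sub>F n in sequentially. (cmod ((z(i := w)) n))\<^sup>2 = (cmod (z n))\<^sup>2"
    using eventually_gt_at_top[of i] by eventually_elim auto
  then show ?thesis unfolding ell2_def by (simp add: summable_cong)
qed

section \<open>The product measure restricted to square-summable sequences\<close>

locale gaussian_ell2 =
  fixes r :: real and a :: "nat \<Rightarrow> real"
  assumes r_pos: "0 < r" and a_pos: "\<And>i. 0 < a i"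
begin

abbreviation P :: "cseq measure" where
  "P \<equiv> ell2_measure r a"

definition Pi_measure :: "cseq measure" where
  "Pi_measure = (\<Pi>\<^sub>M i\<in>UNIV. complex_gaussian (r * a i))"

lemma ra_pos: "0 < r * a i"
  using r_pos a_pos by simp

lemma prob_space_Pi_measure: "prob_space Pi_measure"
  unfolding Pi_measure_def by (rule prob_space_PiM) (rule prob_space_complex_gaussian[OF ra_pos])

lemma sets_Pi_measure [measurable_cong]: "sets Pi_measure = sets borel"
proof -
  have "sets Pi_measure = sets (\<Pi>\<^sub>M i\<in>(UNIV :: nat set). (borel :: complex measure))"
    unfolding Pi_measure_def by (rule sets_PiM_cong) auto
  also have "\<dots> = sets borel" by (rule sets_PiM_equal_borel)
  finally show ?thesis .
qed

lemma space_Pi_measure [simp]: "space Pi_measure = UNIV"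
  using sets_eq_imp_space_eq[OF sets_Pi_measure] by simp

text \<open>Summability of nonnegative terms means finiteness of the series in
  \<open>ennreal\<close>, and that series is a measurable function of z.\<close>

lemma ell2_sets: "ell2 \<in> sets Pi_measure"
proof -
  have "ell2 = {z. (\<Sum>i. ennreal ((cmod (z i))\<^sup>2)) \<noteq> top}"
  proof -
    have "summable (\<lambda>i. (cmod (z i))\<^sup>2) \<longleftrightarrow> (\<Sum>i. ennreal ((cmod (z i))\<^sup>2)) \<noteq> top" for z :: cseq
    proof
      assume "summable (\<lambda>i. (cmod (z i))\<^sup>2)"
      then show "(\<Sum>i. ennreal ((cmod (z i))\<^sup>2)) \<noteq> top"
        by (subst suminf_ennreal2) auto
    qed (rule summable_suminf_not_top, simp)
    then show ?thesis by (simp add: ell2_def)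
  qed
  also have "\<dots> = {z \<in> space (\<Pi>\<^sub>M i\<in>(UNIV :: nat set). (borel :: complex measure)).
      (\<Sum>i. ennreal ((cmod (z i))\<^sup>2)) \<noteq> top}"
    by (simp add: space_PiM)
  also have "\<dots> \<in> sets (\<Pi>\<^sub>M i\<in>(UNIV :: nat set). (borel :: complex measure))"
    by measurable
  finally show ?thesis
    by (simp add: sets_Pi_measure sets_PiM_equal_borel)
qed

lemma P_restrict: "P = restrict_space Pi_measure ell2"
  by (simp add: ell2_measure_def Pi_measure_def)

lemma integrable_P_iff:
  fixes F :: "cseq \<Rightarrow> 'a::{banach, second_countable_topology}"
  shows "integrable P F \<longleftrightarrow> integrable Pi_measure (\<lambda>z. indicator ell2 z *\<^sub>R F z)"
  unfolding P_restrict using ell2_sets by (subst integrable_restrict_space) auto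

lemma integral_P:
  fixes F :: "cseq \<Rightarrow> 'a::{banach, second_countable_topology}"
  shows "(\<integral>z. F z \<partial>P) = (\<integral>z. indicator ell2 z *\<^sub>R F z \<partial>Pi_measure)"
  unfolding P_restrict using ell2_sets by (subst integral_restrict_space) auto

lemma measurable_P: "F \<in> borel_measurable borel \<Longrightarrow> F \<in> borel_measurable P"
  unfolding P_restrict
  by (rule measurable_restrict_space1) (simp add: measurable_cong_sets[OF sets_Pi_measure refl])

text \<open>Bounding the p-th power of a sum by the sum of p-th powers adds one coordinate at a
  time, so moments of the marginals suffice and no joint moments have to be factored.\<close>

lemma integrable_Pi_poly_weight: "integrable Pi_measure (\<lambda>z. poly_weight n z ^ p)"
proof (induction n)
  case 0
  interpret prob_space Pi_measure by (rule prob_space_Pi_measure)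
  show ?case by (simp add: poly_weight_def)
next
  case (Suc n)
  have "integrable (complex_gaussian (r * a n)) (\<lambda>w. complex_of_real (cmod w ^ p))"
    by (rule integrable_complex_gaussian_poly[OF ra_pos, where C = 1 and p = p])
      (auto intro!: power_mono simp: norm_power)
  then have "integrable (complex_gaussian (r * a n)) (\<lambda>w. cmod w ^ p)"
    by (simp only: complex_of_real_integrable_eq)
  moreover have "distr Pi_measure (complex_gaussian (r * a n)) (\<lambda>z. z n) = complex_gaussian (r * a n)"
    unfolding Pi_measure_def
    by (rule distr_PiM_component) (auto intro: prob_space_complex_gaussian ra_pos)
  moreover have "(\<lambda>z. z n) \<in> measurable Pi_measure (complex_gaussian (r * a n))"
    unfolding Pi_measure_def by measurable
  ultimately have "integrable Pi_measure (\<lambda>z. cmod (z n) ^ p)"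
    using integrable_distr[of "\<lambda>z. z n" Pi_measure "complex_gaussian (r * a n)" "\<lambda>w. cmod w ^ p"] by simp
  with Suc.IH have *: "integrable Pi_measure (\<lambda>z. 2 ^ p * (poly_weight n z ^ p + cmod (z n) ^ p))"
    by auto
  show ?case
  proof (rule Bochner_Integration.integrable_bound[OF *])
    have "poly_weight (Suc n) \<in> borel_measurable Pi_measure"
      unfolding poly_weight_def Pi_measure_def by measurable
    then show "(\<lambda>z. poly_weight (Suc n) z ^ p) \<in> borel_measurable Pi_measure"
      by measurable
    have "poly_weight (Suc n) z ^ p \<le> 2 ^ p * (poly_weight n z ^ p + cmod (z n) ^ p)" for z
      unfolding poly_weight_Suc using poly_weight_ge_1[of n z] by (intro add_power_le) auto
    then show "AE z in Pi_measure. norm (poly_weight (Suc n) z ^ p) \<le>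
        norm (2 ^ p * (poly_weight n z ^ p + cmod (z n) ^ p))"
      using order_trans[OF zero_le_one poly_weight_ge_1]
      by (intro AE_I2) (simp add: abs_of_nonneg)
  qed
qed

lemma integrable_moderate_Pi:
  assumes "F \<in> borel_measurable borel" "moderate F"
  shows "integrable Pi_measure (\<lambda>z. indicator ell2 z *\<^sub>R F z)"
proof -
  from assms(2) obtain C n p where *: "\<And>z. cmod (F z) \<le> C * poly_weight n z ^ p"
    unfolding moderate_def by blast
  show ?thesis
  proof (rule Bochner_Integration.integrable_bound)
    show "integrable Pi_measure (\<lambda>z. C * poly_weight n z ^ p)"
      using integrable_Pi_poly_weight by simp
    have "F \<in> borel_measurable Pi_measure"
      using assms(1) by (simp add: measurable_cong_sets[OF sets_Pi_measure refl])
    then show "(\<lambda>z. indicator ell2 z *\<^sub>R F z) \<in> borel_measurable Pi_measure"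
      using ell2_sets by measurable
    have "norm (indicator ell2 z *\<^sub>R F z) \<le> norm (C * poly_weight n z ^ p)" for z
      using order_trans[OF norm_ge_zero *[of z]] *[of z] by (auto simp: indicator_def)
    then show "AE z in Pi_measure. norm (indicator ell2 z *\<^sub>R F z) \<le> norm (C * poly_weight n z ^ p)"
      by simp
  qed
qed

lemma integrable_moderate: "F \<in> borel_measurable borel \<Longrightarrow> moderate F \<Longrightarrow> integrable P F"
  by (simp add: integrable_P_iff integrable_moderate_Pi)

text \<open>Changing one coordinate does not affect membership in \<open>\<ell>\<^sup>2\<close>, so the restriction of the
  product measure to \<open>\<ell>\<^sup>2\<close> is compatible with Fubini in that coordinate, whether or not \<open>\<ell>\<^sup>2\<close> has
  full measure.\<close>

lemma integral_P_resample:
  assumes "F \<in> borel_measurable borel" "moderate F"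
  shows "(\<integral>z. F z \<partial>P) =
    (\<integral>z. indicator ell2 z *\<^sub>R (\<integral>w. F (z(i := w)) \<partial>complex_gaussian (r * a i)) \<partial>Pi_measure)"
proof -
  interpret G: prob_space "complex_gaussian (r * a i)" by (rule prob_space_complex_gaussian[OF ra_pos])
  interpret Q: prob_space Pi_measure by (rule prob_space_Pi_measure)
  interpret GQ: pair_prob_space "complex_gaussian (r * a i)" Pi_measure ..
  let ?F = "\<lambda>z. indicator ell2 z *\<^sub>R F z"
  let ?T = "\<lambda>(w, z). (z :: cseq)(i := w)"
  have D: "distr (complex_gaussian (r * a i) \<Otimes>\<^sub>M Pi_measure) Pi_measure ?T = Pi_measure"
    using distr_pair_PiM_eq_PiM[of UNIV "\<lambda>i. complex_gaussian (r * a i)" i]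
      prob_space_complex_gaussian[OF ra_pos]
    by (simp add: Pi_measure_def)
  have T: "?T \<in> measurable (complex_gaussian (r * a i) \<Otimes>\<^sub>M Pi_measure) Pi_measure"
    unfolding Pi_measure_def case_prod_unfold by (rule measurable_fun_upd[where J = UNIV]) simp_all
  have int: "integrable Pi_measure ?F" by (rule integrable_moderate_Pi[OF assms])
  have Fm: "?F \<in> borel_measurable Pi_measure" using int by simp
  have "integrable (distr (complex_gaussian (r * a i) \<Otimes>\<^sub>M Pi_measure) Pi_measure ?T) ?F"
    using int by (simp add: D)
  then have intT: "integrable (complex_gaussian (r * a i) \<Otimes>\<^sub>M Pi_measure) (\<lambda>(w, z). ?F (z(i := w)))"
    using integrable_distr_eq[OF T Fm] by (simp add: case_prod_unfold)
  have "(\<integral>z. F z \<partial>P) = (\<integral>z. ?F z \<partial>distr (complex_gaussian (r * a i) \<Otimes>\<^sub>M Pi_measure) Pi_measure ?T)"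
    by (simp add: integral_P D)
  also have "\<dots> = (\<integral>(w, z). ?F (z(i := w)) \<partial>(complex_gaussian (r * a i) \<Otimes>\<^sub>M Pi_measure))"
    using integral_distr[OF T Fm] by (simp add: case_prod_unfold)
  also have "\<dots> = (\<integral>z. \<integral>w. ?F (z(i := w)) \<partial>complex_gaussian (r * a i) \<partial>Pi_measure)"
    using GQ.integral_snd[OF intT] by simp
  also have "\<dots> = (\<integral>z. indicator ell2 z *\<^sub>R (\<integral>w. F (z(i := w)) \<partial>complex_gaussian (r * a i)) \<partial>Pi_measure)"
    by (intro Bochner_Integration.integral_cong) (auto simp: indicator_def ell2_upd_iff)
  finally show ?thesis .
qed

text \<open>Resampling coordinate i on both sides reduces the claim to the complex plane for each
  frozen z. The submultiplicative bound \<open>poly_weight_upd\<close> separates the growth into the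
  constant \<open>C z\<close> and a power of 1 + |w|, as the planar formula demands.\<close>

lemma ell2_integration_by_parts:
  assumes v: "v \<in> directions" and F: "\<And>z t. ((\<lambda>t. F (shift v i t z)) has_vector_derivative F' (shift v i t z)) (at t)"
    and cont: "continuous_on UNIV F" "continuous_on UNIV F'" and mod: "moderate F" "moderate F'"
  shows "(\<integral>z. F' z \<partial>P) = (\<integral>z. complex_of_real (Re (z i * cnj v) / (r * a i)\<^sup>2) * F z \<partial>P)"
proof -
  from moderateE[OF mod(1)] obtain C1 m1 q1 where
    1: "0 \<le> C1" "\<And>n p z. m1 \<le> n \<Longrightarrow> q1 \<le> p \<Longrightarrow> cmod (F z) \<le> C1 * poly_weight n z ^ p" by metis
  from moderateE[OF mod(2)] obtain C2 m2 q2 where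
    2: "0 \<le> C2" "\<And>n p z. m2 \<le> n \<Longrightarrow> q2 \<le> p \<Longrightarrow> cmod (F' z) \<le> C2 * poly_weight n z ^ p" by metis
  define n p where "n = max m1 m2" and "p = max q1 q2"
  define C where "C z = (C1 + C2) * poly_weight n z ^ p" for z
  have bound: "K * poly_weight n (z(i := w)) ^ p \<le> C z * (1 + cmod w) ^ p"
    if "0 \<le> K" "K \<le> C1 + C2" for K z w
  proof -
    have "poly_weight n (z(i := w)) ^ p \<le> (poly_weight n z * (1 + cmod w)) ^ p"
      using poly_weight_ge_1[of n "z(i := w)"] by (intro power_mono poly_weight_upd) auto
    then have "K * poly_weight n (z(i := w)) ^ p \<le> (C1 + C2) * (poly_weight n z * (1 + cmod w)) ^ p"
      using that poly_weight_ge_1[of n "z(i := w)"] by (intro mult_mono) auto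
    then show ?thesis by (simp add: C_def power_mult_distrib mult.assoc)
  qed
  have upd: "continuous_on UNIV (\<lambda>w. z(i := w))" for z :: cseq
  proof (rule continuous_on_coordinatewise_then_product)
    show "continuous_on UNIV (\<lambda>w. (z(i := w)) k)" for k
      by (cases "k = i") (auto intro!: continuous_intros)
  qed
  have inner: "(\<integral>w. F' (z(i := w)) \<partial>complex_gaussian (r * a i)) =
      (\<integral>w. complex_of_real (Re (w * cnj v) / (r * a i)\<^sup>2) * F (z(i := w)) \<partial>complex_gaussian (r * a i))" for z
  proof (rule complex_gaussian_integration_by_parts[OF ra_pos v])
    show "((\<lambda>t. F (z(i := w + t *\<^sub>R v))) has_vector_derivative F' (z(i := w + t *\<^sub>R v))) (at t)" for w t
      using F[of "z(i := w)" t] by (simp add: shift_def)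
    show "continuous_on UNIV (\<lambda>w. F (z(i := w)))" "continuous_on UNIV (\<lambda>w. F' (z(i := w)))"
      by (rule continuous_on_compose2[OF cont(1) upd], simp)
        (rule continuous_on_compose2[OF cont(2) upd], simp)
    show "cmod (F (z(i := w))) \<le> C z * (1 + cmod w) ^ p" for w
      by (rule order_trans[OF 1(2) bound]) (use 1 2 in \<open>auto simp: n_def p_def\<close>)
    show "cmod (F' (z(i := w))) \<le> C z * (1 + cmod w) ^ p" for w
      by (rule order_trans[OF 2(2) bound]) (use 1 2 in \<open>auto simp: n_def p_def\<close>)
  qed
  define H where "H z = complex_of_real (Re (z i * cnj v) / (r * a i)\<^sup>2) * F z" for z
  have contH: "continuous_on UNIV H"
    unfolding H_def using ra_pos[of i] by (intro continuous_intros cont continuous_on_coord) auto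
  have "moderate (\<lambda>z. cnj (z i))" by (rule moderate_cnj_coord)
  then have "moderate (\<lambda>z. complex_of_real (Re (z i * cnj v)))"
    by (rule moderate_norm_le)
      (use v abs_Re_le_cmod abs_Im_le_cmod in auto)
  from moderate_lincomb[OF moderate_mult[OF this mod(1)] mod(1), of "1 / complex_of_real ((r * a i)\<^sup>2)" 0]
  have modH: "moderate H"
    unfolding H_def by (simp add: of_real_divide)
  show ?thesis
    unfolding H_def[symmetric]
    using integral_P_resample[OF _ mod(2), of i] integral_P_resample[OF _ modH, of i] cont(2) contH
    by (simp add: borel_measurable_continuous_onI inner) (simp add: H_def)
qed

end

context gaussian_ell2
begin

subsection \<open>The operators on tempered functions\<close>

abbreviation \<delta> :: "nat \<Rightarrow> (cseq \<Rightarrow> complex) \<Rightarrow> cseq \<Rightarrow> complex" where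
  "\<delta> \<equiv> delta r a"

text \<open>Each real coordinate has variance \<open>(r * a i)\<^sup>2\<close>, so
  \<open>2 * \<kappa> i\<close> is the factor produced by Gaussian integration by parts.\<close>

abbreviation \<kappa> :: "nat \<Rightarrow> complex" where
  "\<kappa> i \<equiv> 1 / complex_of_real (2 * r\<^sup>2 * (a i)\<^sup>2)"

lemma delbar_eq: "delbar i \<phi> = (\<lambda>z. (1/2) * pderiv_dir 1 i \<phi> z + (\<i>/2) * pderiv_dir \<i> i \<phi> z)"
  by (simp add: delbar_def fun_eq_iff field_simps)

text \<open>The nesting and the factor 1 give the formula the shape
  \<open>c * \<phi> z + d * \<psi> z\<close> at each level, in which the rules for linear
  combinations apply literally.\<close>

lemma delta_eq: "\<delta> i \<phi> = (\<lambda>z. (1/2) * pderiv_dir 1 i \<phi> z + 1 * ((-\<i>/2) * pderiv_dir \<i> i \<phi> z + (- \<kappa> i) * (cnj (z i) * \<phi> z)))"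
  by (simp add: delta_def del_def fun_eq_iff field_simps)

lemma tempered_delbar: "tempered \<phi> \<Longrightarrow> tempered (delbar i \<phi>)"
  unfolding delbar_eq by (intro tempered_lincomb tempered_pderiv_dir) auto

lemma tempered_delta: "tempered \<phi> \<Longrightarrow> tempered (\<delta> i \<phi>)"
  unfolding delta_eq by (intro tempered_lincomb tempered_pderiv_dir tempered_cnj_coord_mult) auto

lemma measurable_tempered [measurable_dest]: "tempered \<phi> \<Longrightarrow> \<phi> \<in> borel_measurable borel"
  by (rule borel_measurable_continuous_onI) (rule tempered_continuous)

lemma moderate_mult_cnj: "moderate \<phi> \<Longrightarrow> moderate \<psi> \<Longrightarrow> moderate (\<lambda>z. \<phi> z * cnj (\<psi> z))"
  by (rule moderate_mult, assumption, erule moderate_norm_le) simp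

lemma integrable_tempered_mult_cnj:
  assumes "tempered \<phi>" "tempered \<psi>"
  shows "integrable P (\<lambda>z. \<phi> z * cnj (\<psi> z))"
  using assms
  by (intro integrable_moderate moderate_mult_cnj tempered_moderate borel_measurable_continuous_onI
      continuous_intros tempered_continuous)

lemma tempered_L2: "tempered \<phi> \<Longrightarrow> \<phi> \<in> L2 r a"
proof -
  assume \<phi>: "tempered \<phi>"
  have "integrable P (\<lambda>z. complex_of_real ((cmod (\<phi> z))\<^sup>2))"
    unfolding complex_norm_square by (rule integrable_tempered_mult_cnj[OF \<phi> \<phi>])
  then have "integrable P (\<lambda>z. (cmod (\<phi> z))\<^sup>2)"
    by (simp only: complex_of_real_integrable_eq)
  then show ?thesis
    unfolding L2_def using measurable_P[OF measurable_tempered[OF \<phi>]] by simp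
qed

lemma L2_mult_cnj_integrable:
  assumes "u \<in> L2 r a" "v \<in> L2 r a"
  shows "integrable P (\<lambda>z. u z * cnj (v z))"
proof (rule Bochner_Integration.integrable_bound)
  show "integrable P (\<lambda>z. (cmod (u z))\<^sup>2 + (cmod (v z))\<^sup>2)"
    using assms by (simp add: L2_def)
  have [measurable]: "u \<in> borel_measurable P" "v \<in> borel_measurable P"
    using assms by (auto simp: L2_def)
  have [measurable]: "cnj \<in> borel_measurable borel"
    by (intro borel_measurable_continuous_onI continuous_intros)
  show "(\<lambda>z. u z * cnj (v z)) \<in> borel_measurable P" by measurable
  have "x * y \<le> x\<^sup>2 + y\<^sup>2" if "0 \<le> x" "0 \<le> y" for x y :: real
    using sum_squares_bound[of x y] mult_nonneg_nonneg[OF that] by linarith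
  then have "norm (u z * cnj (v z)) \<le> norm ((cmod (u z))\<^sup>2 + (cmod (v z))\<^sup>2)" for z
    by (simp add: norm_mult)
  then show "AE z in P. norm (u z * cnj (v z)) \<le> norm ((cmod (u z))\<^sup>2 + (cmod (v z))\<^sup>2)"
    by simp
qed

text \<open>Integration by parts applied to the product of \<phi> and the conjugate of \<psi>; the
  Leibniz rule splits the left side into the two derivative integrals.\<close>

lemma pderiv_dir_adjoint:
  assumes v: "v \<in> directions" and \<phi>: "tempered \<phi>" and \<psi>: "tempered \<psi>"
  shows "(\<integral>z. pderiv_dir v i \<phi> z * cnj (\<psi> z) \<partial>P) =
    2 * \<kappa> i * (\<integral>z. complex_of_real (Re (z i * cnj v)) * (\<phi> z * cnj (\<psi> z)) \<partial>P)
    - (\<integral>z. \<phi> z * cnj (pderiv_dir v i \<psi> z) \<partial>P)"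
proof -
  let ?D = "pderiv_dir v i"
  have D: "tempered (?D \<phi>)" "tempered (?D \<psi>)"
    using \<phi> \<psi> v by (auto intro: tempered_pderiv_dir)
  have "(\<integral>z. ?D \<phi> z * cnj (\<psi> z) + \<phi> z * cnj (?D \<psi> z) \<partial>P) =
      (\<integral>z. complex_of_real (Re (z i * cnj v) / (r * a i)\<^sup>2) * (\<phi> z * cnj (\<psi> z)) \<partial>P)"
  proof (rule ell2_integration_by_parts[OF v])
    fix z :: cseq and t :: real
    have "((\<lambda>t. cnj (\<psi> (shift v i t z))) has_vector_derivative cnj (?D \<psi> (shift v i t z))) (at t)"
      by (intro has_vector_derivative_cnj has_vector_derivative_shift tempered_has_pderivs \<psi> v)
    from has_vector_derivative_mult[OF has_vector_derivative_shift[OF tempered_has_pderivs[OF \<phi>] v] this]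
    show "((\<lambda>t. \<phi> (shift v i t z) * cnj (\<psi> (shift v i t z))) has_vector_derivative
        ?D \<phi> (shift v i t z) * cnj (\<psi> (shift v i t z)) + \<phi> (shift v i t z) * cnj (?D \<psi> (shift v i t z))) (at t)"
      by (simp add: add.commute)
  next
    show "moderate (\<lambda>z. \<phi> z * cnj (\<psi> z))"
      using \<phi> \<psi> by (intro moderate_mult_cnj tempered_moderate)
    have "moderate (\<lambda>z. ?D \<phi> z * cnj (\<psi> z))" "moderate (\<lambda>z. \<phi> z * cnj (?D \<psi> z))"
      using \<phi> \<psi> D by (auto intro: moderate_mult_cnj tempered_moderate)
    from moderate_lincomb[OF this, of 1 1]
    show "moderate (\<lambda>z. ?D \<phi> z * cnj (\<psi> z) + \<phi> z * cnj (?D \<psi> z))" by simp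
  qed (use \<phi> \<psi> D in \<open>auto intro!: continuous_intros intro: tempered_continuous\<close>)
  also have "\<dots> = (\<integral>z. (2 * \<kappa> i) * (complex_of_real (Re (z i * cnj v)) * (\<phi> z * cnj (\<psi> z))) \<partial>P)"
    by (intro Bochner_Integration.integral_cong) (auto simp: field_simps power2_eq_square)
  finally show ?thesis
    unfolding Bochner_Integration.integral_add[OF integrable_tempered_mult_cnj[OF D(1) \<psi>]
        integrable_tempered_mult_cnj[OF \<phi> D(2)]] integral_mult_right_zero
    by (simp only: eq_diff_eq)
qed

lemma integrable_coord_tempered:
  assumes "tempered \<phi>" "tempered \<psi>" "v \<in> directions"
  shows "integrable P (\<lambda>z. complex_of_real (Re (z i * cnj v)) * (\<phi> z * cnj (\<psi> z)))"
proof (rule integrable_moderate)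
  have "continuous_on UNIV (\<lambda>z. complex_of_real (Re (z i * cnj v)) * (\<phi> z * cnj (\<psi> z)))"
    using assms by (intro continuous_intros continuous_on_coord tempered_continuous)
  then show "(\<lambda>z. complex_of_real (Re (z i * cnj v)) * (\<phi> z * cnj (\<psi> z))) \<in> borel_measurable borel"
    by (rule borel_measurable_continuous_onI)
  have "moderate (\<lambda>z. complex_of_real (Re (z i * cnj v)))"
    by (rule moderate_norm_le[OF moderate_cnj_coord[of i]])
      (use assms(3) abs_Re_le_cmod abs_Im_le_cmod in auto)
  then show "moderate (\<lambda>z. complex_of_real (Re (z i * cnj v)) * (\<phi> z * cnj (\<psi> z)))"
    using moderate_mult moderate_mult_cnj[OF assms(1,2)[THEN tempered_moderate]] by blast
qed

section \<open>The Hermitian pairing, the adjoint relation and the commutator\<close>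

definition ip :: "(cseq \<Rightarrow> complex) \<Rightarrow> (cseq \<Rightarrow> complex) \<Rightarrow> complex" where
  "ip u v = (\<integral>z. u z * cnj (v z) \<partial>P)"

text \<open>With the weights 1/2 and \<i>/2 on the two real directions, the multipliers Re z_i and
  Im z_i combine to z_i. Moved into the second argument everything is conjugated: z_i becomes the
  conjugate coordinate in \<open>\<delta> i\<close>, and the weight \<i>/2 becomes the -\<i>/2 of
  \<open>del i\<close>.\<close>

lemma delbar_adjoint:
  assumes \<phi>: "tempered \<phi>" and \<psi>: "tempered \<psi>"
  shows "ip (delbar i \<phi>) \<psi> = - ip \<phi> (\<delta> i \<psi>)"
proof -
  have t: "tempered (pderiv_dir v i \<phi>)" "tempered (pderiv_dir v i \<psi>)" if "v \<in> directions" for v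
    using \<phi> \<psi> that by (auto intro: tempered_pderiv_dir)
  note I = integrable_tempered_mult_cnj[OF t(1) \<psi>] integrable_tempered_mult_cnj[OF \<phi> t(2)]
    integrable_coord_tempered[OF \<phi> \<psi>]
  let ?X = "\<lambda>v. \<integral>z. complex_of_real (Re (z i * cnj v)) * (\<phi> z * cnj (\<psi> z)) \<partial>P"
  let ?L = "\<lambda>v. \<integral>z. pderiv_dir v i \<phi> z * cnj (\<psi> z) \<partial>P"
  let ?R = "\<lambda>v. \<integral>z. \<phi> z * cnj (pderiv_dir v i \<psi> z) \<partial>P"
  have "ip (delbar i \<phi>) \<psi> = (\<integral>z. (1/2) * (pderiv_dir 1 i \<phi> z * cnj (\<psi> z)) +
      (\<i>/2) * (pderiv_dir \<i> i \<phi> z * cnj (\<psi> z)) \<partial>P)"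
    unfolding ip_def by (intro Bochner_Integration.integral_cong) (auto simp: delbar_def field_simps)
  also have "\<dots> = (1/2) * ?L 1 + (\<i>/2) * ?L \<i>"
    using I by (subst Bochner_Integration.integral_add) auto
  also have "\<dots> = (1/2) * (2 * \<kappa> i * ?X 1 - ?R 1) + (\<i>/2) * (2 * \<kappa> i * ?X \<i> - ?R \<i>)"
    by (subst (1 2) pderiv_dir_adjoint[OF _ \<phi> \<psi>]) auto
  also have "\<dots> = - ((1/2) * ?R 1 + (\<i>/2) * ?R \<i> + (- \<kappa> i) * (?X 1 + \<i> * ?X \<i>))"
    by (simp add: algebra_simps del: of_real_mult of_real_power)
  also have "?X 1 + \<i> * ?X \<i> = (\<integral>z. z i * (\<phi> z * cnj (\<psi> z)) \<partial>P)"
  proof -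
    have "?X 1 + \<i> * ?X \<i> = (\<integral>z. complex_of_real (Re (z i * cnj 1)) * (\<phi> z * cnj (\<psi> z)) +
        \<i> * (complex_of_real (Re (z i * cnj \<i>)) * (\<phi> z * cnj (\<psi> z))) \<partial>P)"
      using I(3)[of 1 i] I(3)[of \<i> i] by (subst Bochner_Integration.integral_add) auto
    also have "\<dots> = (\<integral>z. z i * (\<phi> z * cnj (\<psi> z)) \<partial>P)"
    proof (intro Bochner_Integration.integral_cong refl)
      fix z :: cseq
      have "complex_of_real (Re (z i * cnj 1)) * w + \<i> * (complex_of_real (Re (z i * cnj \<i>)) * w) =
          (complex_of_real (Re (z i)) + \<i> * complex_of_real (Im (z i))) * w" for w
        by (simp add: algebra_simps)
      then show "complex_of_real (Re (z i * cnj 1)) * (\<phi> z * cnj (\<psi> z)) +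
          \<i> * (complex_of_real (Re (z i * cnj \<i>)) * (\<phi> z * cnj (\<psi> z))) = z i * (\<phi> z * cnj (\<psi> z))"
        by (simp only: complex_eq[symmetric])
    qed
    finally show ?thesis .
  qed
  also have "(1/2) * ?R 1 + (\<i>/2) * ?R \<i> + (- \<kappa> i) * (\<integral>z. z i * (\<phi> z * cnj (\<psi> z)) \<partial>P) =
      (\<integral>z. (1/2) * (\<phi> z * cnj (pderiv_dir 1 i \<psi> z)) + (\<i>/2) * (\<phi> z * cnj (pderiv_dir \<i> i \<psi> z))
        + (- \<kappa> i) * (z i * (\<phi> z * cnj (\<psi> z))) \<partial>P)"
  proof -
    have "integrable P (\<lambda>z. z i * (\<phi> z * cnj (\<psi> z)))"
      using integrable_tempered_mult_cnj[OF \<phi> tempered_cnj_coord_mult[OF \<psi>, of i]]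
      by (simp add: ac_simps)
    then show ?thesis using I(2)[of 1] I(2)[of \<i>]
      by (subst Bochner_Integration.integral_add, simp, simp, subst Bochner_Integration.integral_add) auto
  qed
  also have "\<dots> = ip \<phi> (\<delta> i \<psi>)"
    unfolding ip_def
    by (intro Bochner_Integration.integral_cong) (auto simp: delta_def del_def field_simps)
  finally show ?thesis .
qed

lemma ip_cnj: "cnj (ip u v) = ip v u"
  unfolding ip_def Bochner_Integration.integral_cnj[symmetric] by (simp add: mult.commute del: Bochner_Integration.integral_cnj)

lemma tempered_pderiv_dir_commute:
  assumes "tempered \<phi>" "v \<in> directions" "w \<in> directions"
  shows "pderiv_dir w j (pderiv_dir v i \<phi>) z = pderiv_dir v i (pderiv_dir w j \<phi>) z"
  using assms
  by (intro pderiv_dir_commute tempered_has_pderivs tempered_continuous tempered_pderiv_dir)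

lemma pderiv_dir_delbar:
  assumes \<phi>: "tempered \<phi>" and w: "w \<in> directions"
  shows "pderiv_dir w j (delbar i \<phi>) z =
    (1/2) * pderiv_dir w j (pderiv_dir 1 i \<phi>) z + (\<i>/2) * pderiv_dir w j (pderiv_dir \<i> i \<phi>) z"
  unfolding delbar_eq
  by (rule pderiv_dir_lincomb(2)[OF _ _ w]) (use \<phi> in \<open>auto intro: tempered_has_pderivs tempered_pderiv_dir\<close>)

lemma pderiv_dir_delta:
  assumes \<phi>: "tempered \<phi>" and w: "w \<in> directions"
  shows "pderiv_dir w j (\<delta> i \<phi>) z =
    (1/2) * pderiv_dir w j (pderiv_dir 1 i \<phi>) z + (-\<i>/2) * pderiv_dir w j (pderiv_dir \<i> i \<phi>) z
    - \<kappa> i * (cnj (z i) * pderiv_dir w j \<phi> z + (if j = i then cnj w else 0) * \<phi> z)"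
proof -
  note h = tempered_has_pderivs[OF tempered_pderiv_dir[OF \<phi>]]
  note mult = pderiv_dir_mult[OF cnj_coord_has_vector_derivative[where k = i] tempered_has_pderivs[OF \<phi>]]
  have 1: "has_pderivs (pderiv_dir 1 i \<phi>)" "has_pderivs (pderiv_dir \<i> i \<phi>)" using h by auto
  note s = pderiv_dir_lincomb[OF 1(2) mult(1), where c = "-\<i>/2" and d = "-\<kappa> i"]
  show ?thesis
    unfolding delta_eq pderiv_dir_lincomb(2)[OF 1(1) s(1) w] s(2)[OF w] mult(2)[OF w]
    by (simp add: algebra_simps)
qed

text \<open>The second-order terms agree by symmetry of mixed derivatives. What survives is
  \<open>delbar j\<close> applied to the conjugate of z_i, which for i = j is 1/2 + (\<i>/2) (-\<i>)
  = 1 and otherwise 0.\<close>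

lemma delbar_delta_commute:
  assumes \<phi>: "tempered \<phi>"
  shows "delbar j (\<delta> i \<phi>) z = \<delta> i (delbar j \<phi>) z - (if i = j then \<kappa> i * \<phi> z else 0)"
proof -
  have c: "pderiv_dir w j (pderiv_dir v i \<phi>) z = pderiv_dir v i (pderiv_dir w j \<phi>) z"
    if "v \<in> directions" "w \<in> directions" for v w
    using tempered_pderiv_dir_commute[OF \<phi>] that by blast
  have l: "delbar j (\<delta> i \<phi>) z = (1/2) * pderiv_dir 1 j (\<delta> i \<phi>) z + (\<i>/2) * pderiv_dir \<i> j (\<delta> i \<phi>) z"
    by (simp add: delbar_eq)
  have r: "\<delta> i (delbar j \<phi>) z = (1/2) * pderiv_dir 1 i (delbar j \<phi>) z + (-\<i>/2) * pderiv_dir \<i> i (delbar j \<phi>) z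
      - \<kappa> i * (cnj (z i) * delbar j \<phi> z)"
    by (simp add: delta_eq)
  define K where "K = \<kappa> i"
  show ?thesis
    unfolding l r
    unfolding pderiv_dir_delta[OF \<phi> insertI1] pderiv_dir_delta[OF \<phi> insertI2[OF insertI1]]
      pderiv_dir_delbar[OF \<phi> insertI1] pderiv_dir_delbar[OF \<phi> insertI2[OF insertI1]]
    unfolding delbar_eq K_def[symmetric]
    by (simp add: c algebra_simps)
qed

lemma ip_delta_left:
  assumes "tempered \<phi>" "tempered \<psi>"
  shows "ip (\<delta> i \<phi>) \<psi> = - ip \<phi> (delbar i \<psi>)"
  using arg_cong[OF delbar_adjoint[OF assms(2,1), of i], of cnj] by (simp add: ip_cnj)

text \<open>Two uses of the adjoint relation with one commutation in between. The minus sign of the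
  commutator meets the minus sign of the first adjunction, so the extra term is positive on the
  diagonal; this is the source of the lower bound.\<close>

lemma ip_delta_delta:
  assumes u: "tempered u" and v: "tempered v"
  shows "ip (\<delta> i u) (\<delta> j v) = ip (delbar j u) (delbar i v) + (if i = j then \<kappa> i * ip u v else 0)"
proof -
  have "ip (\<delta> i u) (\<delta> j v) = - ip (delbar j (\<delta> i u)) v"
    using delbar_adjoint[OF tempered_delta[OF u] v] by simp
  also have "ip (delbar j (\<delta> i u)) v =
      (\<integral>z. \<delta> i (delbar j u) z * cnj (v z) - (if i = j then \<kappa> i else 0) * (u z * cnj (v z)) \<partial>P)"
    unfolding ip_def
    by (intro Bochner_Integration.integral_cong) (auto simp: delbar_delta_commute[OF u] algebra_simps)
  also have "\<dots> = ip (\<delta> i (delbar j u)) v - (if i = j then \<kappa> i else 0) * ip u v"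
    unfolding ip_def using u v
    by (subst Bochner_Integration.integral_diff)
      (auto intro!: integrable_tempered_mult_cnj tempered_delta tempered_delbar)
  also have "ip (\<delta> i (delbar j u)) v = - ip (delbar j u) (delbar i v)"
    by (rule ip_delta_left[OF tempered_delbar[OF u] v])
  finally show ?thesis by simp
qed

end

subsection \<open>Signs of multi-indices\<close>

text \<open>Counts the entries that j must pass when \<open>j # J\<close> is sorted; a closed form
  of \<open>eps\<close> for K = J + j, as \<open>eps_insort\<close> shows.\<close>

definition isign :: "nat \<Rightarrow> nat list \<Rightarrow> int" where
  "isign j J = (-1) ^ card {x \<in> set J. x < j}"

lemma isign_square: "isign j J * isign j J = 1"
  by (simp add: isign_def power_add[symmetric] mult_2[symmetric] del: mult_2)

text \<open>Exactly one of i and j is smaller than the other. Inserting the smaller one raises the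
  count of the larger by one; inserting the larger one leaves the count of the smaller alone. In
  total one sign changes.\<close>

lemma isign_insort:
  assumes "i \<noteq> j" "i \<notin> set J" "j \<notin> set J"
  shows "isign i (insort j J) * isign j (insort i J) = - (isign i J * isign j J)"
proof -
  have ins: "{x \<in> set (insort k J). x < l} = (if k < l then insert k {x \<in> set J. x < l} else {x \<in> set J. x < l})"
    for k l by (auto simp: set_insort_key)
  have "card {x \<in> set (insort k J). x < l} = card {x \<in> set J. x < l} + (if k < l then 1 else 0)"
    if "k \<notin> set J" for k l
    unfolding ins using that by simp
  with assms show ?thesis
    by (cases i j rule: linorder_cases) (simp_all add: isign_def)
qed

text \<open>Since \<open>permute_list p xs\<close> reads position \<open>p k\<close> at place k,
  this cycle moves the head of a list to place m. Building it from m adjacent transpositions makes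
  its sign evident.\<close>

fun cycle_to_front :: "nat \<Rightarrow> nat \<Rightarrow> nat" where
  "cycle_to_front 0 = id"
| "cycle_to_front (Suc m) = cycle_to_front m \<circ> Transposition.transpose m (Suc m)"

lemma cycle_to_front_apply:
  "cycle_to_front m k = (if k < m then Suc k else if k = m then 0 else k)"
  by (induction m arbitrary: k) (auto simp: Transposition.transpose_def)

lemma cycle_to_front_permutes: "m < n \<Longrightarrow> cycle_to_front m permutes {..<n}"
proof (induction m)
  case 0
  show ?case by (simp add: permutes_id[unfolded id_def] id_def)
next
  case (Suc m)
  then show ?case
    unfolding cycle_to_front.simps(2) by (intro permutes_compose permutes_swap_id) auto
qed

lemma sign_cycle_to_front: "sign (cycle_to_front m) = (-1) ^ m"
proof (induction m)
  case (Suc m)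
  have "permutation (cycle_to_front m)"
    using cycle_to_front_permutes[of m "Suc m"] permutation_permutes by blast
  then show ?case
    using Suc unfolding cycle_to_front.simps(2)
    by (subst sign_compose) (simp_all add: permutation_swap_id sign_swap_id)
qed simp

lemma permute_list_cycle_to_front:
  assumes "m \<le> length J"
  shows "permute_list (cycle_to_front m) (j # J) = take m J @ j # drop m J"
proof (rule nth_equalityI)
  fix k assume "k < length (permute_list (cycle_to_front m) (j # J))"
  then have "k < Suc (length J)" by simp
  then show "permute_list (cycle_to_front m) (j # J) ! k = (take m J @ j # drop m J) ! k"
    using assms by (auto simp: permute_list_def cycle_to_front_apply nth_append nth_Cons'
        simp del: upt_Suc)
qed (use assms in simp)

lemma insort_take_drop:
  assumes "sorted_wrt (<) J" "j \<notin> set J"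
  shows "card {x \<in> set J. x < j} \<le> length J \<and>
    insort j J = take (card {x \<in> set J. x < j}) J @ j # drop (card {x \<in> set J. x < j}) (J :: nat list)"
  using assms
proof (induction J)
  case (Cons x xs)
  show ?case
  proof (cases "j < x")
    case True
    then have "{y \<in> set (x # xs). y < j} = {}" using Cons.prems by auto
    with True show ?thesis by (simp only: card.empty) simp
  next
    case False
    then have "x < j" using Cons.prems by auto
    then have "{y \<in> set (x # xs). y < j} = insert x {y \<in> set xs. y < j}" by auto
    moreover have "x \<notin> set xs" using Cons.prems by auto
    ultimately have "card {y \<in> set (x # xs). y < j} = Suc (card {y \<in> set xs. y < j})" by simp
    with Cons \<open>x < j\<close> show ?thesis by (simp only:) simp
  qed
qed simp

lemma permute_list_inj:
  assumes "distinct xs" "p permutes {..<length xs}" "q permutes {..<length xs}"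
    and "permute_list p xs = permute_list q xs"
  shows "p = q"
proof
  fix k
  show "p k = q k"
  proof (cases "k < length xs")
    case True
    then have "p k < length xs" "q k < length xs"
      using permutes_in_image[OF assms(2)] permutes_in_image[OF assms(3)] by auto
    moreover have "xs ! p k = xs ! q k"
      using assms(4) permute_list_nth[OF assms(2) True] permute_list_nth[OF assms(3) True] by metis
    ultimately show ?thesis using assms(1) nth_eq_iff_index_eq by blast
  next
    case False
    then show ?thesis using assms(2,3) by (simp add: permutes_def)
  qed
qed

text \<open>The definite description in \<open>eps\<close> is resolved by a witness, the cycle that
  moves j past the m smaller entries, and by uniqueness, since a list without repetitions determines
  the permutation.\<close>

lemma eps_insort:
  assumes J: "sorted_wrt (<) J" and j: "j \<notin> set J"
  shows "eps (insort j J) j J = isign j J"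
proof -
  define m where "m = card {x \<in> set J. x < j}"
  have m: "m \<le> length J" "insort j J = take m J @ j # drop m J"
    using insort_take_drop[OF assms] by (auto simp: m_def)
  let ?P = "\<lambda>p. p permutes {..<length (insort j J)} \<and> permute_list p (j # J) = insort j J"
  have P: "?P (cycle_to_front m)"
    using m permute_list_cycle_to_front[OF m(1), of j] cycle_to_front_permutes[of m "Suc (length J)"]
    by simp
  have "(THE p. ?P p) = cycle_to_front m"
  proof (rule the_equality)
    show "?P (cycle_to_front m)" by (rule P)
    have "distinct (j # J)" using J j by (simp add: strict_sorted_iff)
    then show "p = cycle_to_front m" if "?P p" for p
      by (rule permute_list_inj) (use that P in auto)
  qed
  then show ?thesis
    by (simp add: eps_def set_insort_key sign_cycle_to_front isign_def m_def)
qed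

section \<open>Inserting into and removing from multi-indices\<close>

lemma multi_indices_insort: "J \<in> multi_indices t \<Longrightarrow> i \<notin> set J \<Longrightarrow> insort i J \<in> multi_indices (Suc t)"
  by (simp add: multi_indices_def strict_sorted_iff sorted_insort distinct_insort)

lemma multi_indices_remove1: "K \<in> multi_indices (Suc t) \<Longrightarrow> i \<in> set K \<Longrightarrow> remove1 i K \<in> multi_indices t"
  by (auto simp: multi_indices_def strict_sorted_iff sorted_remove1 distinct_remove1 length_remove1)

lemma multi_indices_distinct: "K \<in> multi_indices t \<Longrightarrow> distinct K"
  by (simp add: multi_indices_def strict_sorted_iff)

lemma multi_indices_insort_remove1: "K \<in> multi_indices t \<Longrightarrow> i \<in> set K \<Longrightarrow> insort i (remove1 i K) = K"
  by (simp add: multi_indices_def strict_sorted_iff insort_remove1)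

lemma multi_indices_not_in_remove1: "K \<in> multi_indices t \<Longrightarrow> i \<notin> set (remove1 i K)"
  using multi_indices_distinct by (simp add: set_remove1_eq)

lemma eps_remove1:
  assumes "K \<in> multi_indices (Suc t)" "i \<in> set K"
  shows "eps K i (remove1 i K) = isign i (remove1 i K)"
  using eps_insort[of "remove1 i K" i] multi_indices_remove1[OF assms]
    multi_indices_insort_remove1[OF assms] multi_indices_not_in_remove1[OF assms(1)]
  by (simp add: multi_indices_def)

text \<open>If \<open>eps\<close> is nonzero, then cardinalities force i outside J, and a strictly
  sorted list is determined by its set. So for given K and i at most one J contributes.\<close>

lemma eps_eq_0:
  assumes "K \<in> multi_indices (Suc t)" "J \<in> multi_indices t" "\<not> (i \<in> set K \<and> J = remove1 i K)"
  shows "eps K i J = 0"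
proof (rule ccontr)
  assume "eps K i J \<noteq> 0"
  then have KJ: "set K = insert i (set J)" by (simp add: eps_def split: if_splits)
  have "card (set K) = Suc t" "card (set J) = t"
    using assms by (auto simp: multi_indices_def strict_sorted_iff distinct_card)
  with KJ have "i \<notin> set J" by (metis card_insert_if finite_set n_not_Suc_n)
  then have "set (remove1 i K) = set J"
    using KJ multi_indices_distinct[OF assms(1)] by (simp add: set_remove1_eq)
  then have "remove1 i K = J"
    using multi_indices_remove1[OF assms(1), of i] assms(2) KJ
    by (intro strict_sorted_equal) (auto simp: multi_indices_def)
  with KJ assms(3) show False by auto
qed

subsection \<open>Sums over multi-indices\<close>

text \<open>The cut-off N turns the sums over infinitely many multi-indices into finite ones; every
  form with finitely many nonzero coefficients fits below some N.\<close>

definition bounded_indices :: "nat \<Rightarrow> nat \<Rightarrow> nat list set" where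
  "bounded_indices N t = {J \<in> multi_indices t. set J \<subseteq> {..<N}}"

lemma finite_bounded_indices [simp]: "finite (bounded_indices N t)"
  by (rule finite_subset[OF _ finite_lists_length_eq[of "{..<N}" t]])
    (auto simp: bounded_indices_def multi_indices_def)

lemma bounded_indices_subset: "bounded_indices N t \<subseteq> multi_indices t"
  by (auto simp: bounded_indices_def)

text \<open>Double counting of the pairs J < K with K = J + i: either choose K and the entry i to
  delete, or J and the index i to insert. This regrouping passes between forms of neighbouring
  degrees, both for the adjoint and in the estimate.\<close>

lemma sum_bounded_indices_Suc:
  fixes H :: "nat \<Rightarrow> nat list \<Rightarrow> nat list \<Rightarrow> 'b::comm_monoid_add"
  shows "(\<Sum>K\<in>bounded_indices N (Suc t). \<Sum>i\<in>set K. H i (remove1 i K) K) =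
    (\<Sum>J\<in>bounded_indices N t. \<Sum>i\<in>{..<N} - set J. H i J (insort i J))"
proof -
  have "(\<Sum>(K, i)\<in>Sigma (bounded_indices N (Suc t)) set. H i (remove1 i K) K) =
      (\<Sum>(J, i)\<in>Sigma (bounded_indices N t) (\<lambda>J. {..<N} - set J). H i J (insort i J))"
  proof (rule sum.reindex_bij_witness[where i = "\<lambda>(J, i). (insort i J, i)" and j = "\<lambda>(K, i). (remove1 i K, i)"])
    fix p assume "p \<in> Sigma (bounded_indices N (Suc t)) set"
    then obtain K i where p: "p = (K, i)" "K \<in> multi_indices (Suc t)" "set K \<subseteq> {..<N}" "i \<in> set K"
      by (auto simp: bounded_indices_def)
    note K = multi_indices_insort_remove1[OF p(2,4)] multi_indices_not_in_remove1[OF p(2), of i]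
      multi_indices_remove1[OF p(2,4)]
    show "(case case p of (K, i) \<Rightarrow> (remove1 i K, i) of (J, i) \<Rightarrow> (insort i J, i)) = p"
      using K p by simp
    show "(case p of (K, i) \<Rightarrow> (remove1 i K, i)) \<in> Sigma (bounded_indices N t) (\<lambda>J. {..<N} - set J)"
      using K p notin_set_remove1 set_remove1_subset[of i K] by (auto simp: bounded_indices_def)
    show "(case case p of (K, i) \<Rightarrow> (remove1 i K, i) of (J, i) \<Rightarrow> H i J (insort i J)) =
        (case p of (K, i) \<Rightarrow> H i (remove1 i K) K)"
      using K p by simp
  next
    fix q assume "q \<in> Sigma (bounded_indices N t) (\<lambda>J. {..<N} - set J)"
    then obtain J i where q: "q = (J, i)" "J \<in> multi_indices t" "set J \<subseteq> {..<N}" "i < N" "i \<notin> set J"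
      by (auto simp: bounded_indices_def)
    show "(case case q of (J, i) \<Rightarrow> (insort i J, i) of (K, i) \<Rightarrow> (remove1 i K, i)) = q"
      using q by simp
    show "(case q of (J, i) \<Rightarrow> (insort i J, i)) \<in> Sigma (bounded_indices N (Suc t)) set"
      using q multi_indices_insort[OF q(2,5)] by (auto simp: bounded_indices_def set_insort_key)
  qed
  then show ?thesis by (simp add: sum.Sigma)
qed

definition iweight :: "(nat \<Rightarrow> real) \<Rightarrow> nat list \<Rightarrow> real" where
  "iweight a J = prod_list (map (\<lambda>j. (a j)\<^sup>2) J)"

lemma weight_eq: "weight a I J = iweight a I * iweight a J"
  by (simp add: weight_def iweight_def)

lemma iweight_insort: "iweight a (insort i J) = (a i)\<^sup>2 * iweight a J"
  by (induction J) (auto simp: iweight_def ac_simps)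

lemma iweight_nonneg: "0 \<le> iweight a J"
  by (induction J) (auto simp: iweight_def)

lemma weight_nonneg: "0 \<le> weight a I J"
  by (simp add: weight_eq iweight_nonneg)

lemma infsum_eps:
  fixes F :: "nat \<Rightarrow> nat list \<Rightarrow> complex"
  assumes K: "K \<in> multi_indices (Suc t)"
  shows "(\<Sum>\<^sub>\<infinity>i\<in>UNIV. \<Sum>\<^sub>\<infinity>J\<in>multi_indices t. of_int (eps K i J) * F i J) =
    (\<Sum>i\<in>set K. of_int (isign i (remove1 i K)) * F i (remove1 i K))"
proof -
  have "(\<Sum>\<^sub>\<infinity>J\<in>multi_indices t. of_int (eps K i J) * F i J) =
      of_int (isign i (remove1 i K)) * F i (remove1 i K)" if i: "i \<in> set K" for i
  proof -
    have "(\<Sum>\<^sub>\<infinity>J\<in>multi_indices t. of_int (eps K i J) * F i J) =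
        (\<Sum>\<^sub>\<infinity>J\<in>{remove1 i K}. of_int (eps K i J) * F i J)"
      by (rule infsum_cong_neutral) (use eps_eq_0[OF K] multi_indices_remove1[OF K i] in auto)
    then show ?thesis using eps_remove1[OF K i] by simp
  qed
  moreover have "(\<Sum>\<^sub>\<infinity>J\<in>multi_indices t. of_int (eps K i J) * F i J) = 0" if "i \<notin> set K" for i
    by (rule infsum_0) (use eps_eq_0[OF K] that in auto)
  ultimately have "(\<Sum>\<^sub>\<infinity>i\<in>UNIV. \<Sum>\<^sub>\<infinity>J\<in>multi_indices t. of_int (eps K i J) * F i J) =
      (\<Sum>\<^sub>\<infinity>i\<in>set K. of_int (isign i (remove1 i K)) * F i (remove1 i K))"
    by (intro infsum_cong_neutral) auto
  then show ?thesis by simp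
qed

lemma sum_diag_offdiag:
  fixes T :: "'a \<Rightarrow> 'a \<Rightarrow> 'b::comm_monoid_add"
  assumes "finite A"
  shows "(\<Sum>i\<in>A. \<Sum>j\<in>A. T i j) = (\<Sum>i\<in>A. T i i) + (\<Sum>i\<in>A. \<Sum>j\<in>A - {i}. T i j)"
  unfolding sum.distrib[symmetric] using assms by (intro sum.cong refl) (simp add: sum.remove)

context gaussian_ell2
begin

subsection \<open>Forms with tempered coefficients\<close>

definition nsq :: "(cseq \<Rightarrow> complex) \<Rightarrow> real" where
  "nsq u = (\<integral>z. (cmod (u z))\<^sup>2 \<partial>P)"

lemma nsq_nonneg: "0 \<le> nsq u"
  by (simp add: nsq_def)

lemma nsq_zero [simp]: "nsq (\<lambda>_. 0) = 0"
  by (simp add: nsq_def)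

lemma ip_self: "ip u u = complex_of_real (nsq u)"
  unfolding ip_def nsq_def complex_norm_square[symmetric] by (rule integral_complex_of_real)

lemma Re_ip_self: "Re (ip u u) = nsq u"
  by (simp add: ip_self)

text \<open>Stands in for the Cauchy-Schwarz inequality: if u and v satisfy
  \<open>ip u v = ip v v\<close>, it gives \<open>nsq v \<le> nsq u\<close>.\<close>

lemma Re_ip_le:
  assumes "u \<in> L2 r a" "v \<in> L2 r a"
  shows "2 * Re (ip u v) \<le> nsq u + nsq v"
proof -
  have int: "integrable P (\<lambda>z. (cmod (u z))\<^sup>2)" "integrable P (\<lambda>z. (cmod (v z))\<^sup>2)"
    using assms by (auto simp: L2_def)
  have "2 * Re (ip u v) = (\<integral>z. 2 * Re (u z * cnj (v z)) \<partial>P)"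
    unfolding ip_def integral_Re[OF L2_mult_cnj_integrable[OF assms], symmetric] integral_mult_right_zero ..
  also have "\<dots> \<le> (\<integral>z. (cmod (u z))\<^sup>2 + (cmod (v z))\<^sup>2 \<partial>P)"
  proof (rule integral_mono)
    show "integrable P (\<lambda>z. 2 * Re (u z * cnj (v z)))"
      by (intro integrable_mult_right integrable_Re L2_mult_cnj_integrable assms)
    show "2 * Re (u z * cnj (v z)) \<le> (cmod (u z))\<^sup>2 + (cmod (v z))\<^sup>2" for z
      using complex_Re_le_cmod[of "u z * cnj (v z)"] sum_squares_bound[of "cmod (u z)" "cmod (v z)"]
      by (simp add: norm_mult)
  qed (use int in simp)
  finally show ?thesis using int by (simp add: nsq_def)
qed

lemma ip_sum_right:
  assumes "finite A" "u \<in> L2 r a" "\<And>i. i \<in> A \<Longrightarrow> v i \<in> L2 r a"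
  shows "ip u (\<lambda>z. \<Sum>i\<in>A. c i * v i z) = (\<Sum>i\<in>A. cnj (c i) * ip u (v i))"
proof -
  have "ip u (\<lambda>z. \<Sum>i\<in>A. c i * v i z) = (\<integral>z. (\<Sum>i\<in>A. cnj (c i) * (u z * cnj (v i z))) \<partial>P)"
    unfolding ip_def by (intro Bochner_Integration.integral_cong) (auto simp: sum_distrib_left ac_simps)
  also have "\<dots> = (\<Sum>i\<in>A. \<integral>z. cnj (c i) * (u z * cnj (v i z)) \<partial>P)"
    by (intro Bochner_Integration.integral_sum integrable_mult_right L2_mult_cnj_integrable assms)
  finally show ?thesis by (simp add: ip_def)
qed

lemma ip_sum_left:
  assumes "finite A" "u \<in> L2 r a" "\<And>i. i \<in> A \<Longrightarrow> v i \<in> L2 r a"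
  shows "ip (\<lambda>z. \<Sum>i\<in>A. c i * v i z) u = (\<Sum>i\<in>A. c i * ip (v i) u)"
proof -
  have "ip u (\<lambda>z. \<Sum>i\<in>A. c i * v i z) = (\<Sum>i\<in>A. cnj (c i) * ip u (v i))"
    by (rule ip_sum_right[OF assms])
  from arg_cong[OF this, of cnj] show ?thesis by (simp add: ip_cnj)
qed

lemma nsq_sum:
  fixes \<alpha> :: "'i \<Rightarrow> real"
  assumes "finite A" "\<And>i. i \<in> A \<Longrightarrow> tempered (\<phi> i)"
  shows "nsq (\<lambda>z. \<Sum>i\<in>A. complex_of_real (\<alpha> i) * \<phi> i z) =
    (\<Sum>i\<in>A. \<Sum>j\<in>A. \<alpha> i * \<alpha> j * Re (ip (\<phi> i) (\<phi> j)))"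
proof -
  let ?S = "\<lambda>z. \<Sum>i\<in>A. complex_of_real (\<alpha> i) * \<phi> i z"
  have S: "?S \<in> L2 r a"
    using assms by (intro tempered_L2 tempered_sum tempered_cmult)
  have "ip ?S ?S = (\<Sum>i\<in>A. complex_of_real (\<alpha> i) * (\<Sum>j\<in>A. complex_of_real (\<alpha> j) * ip (\<phi> i) (\<phi> j)))"
    using assms S by (simp add: ip_sum_left ip_sum_right tempered_L2)
  then have "nsq ?S = Re (\<Sum>i\<in>A. \<Sum>j\<in>A. complex_of_real (\<alpha> i * \<alpha> j) * ip (\<phi> i) (\<phi> j))"
    unfolding Re_ip_self[symmetric] by (simp add: sum_distrib_left mult.assoc)
  then show ?thesis by simp
qed

text \<open>One N bounds both the entries of the relevant multi-indices and the variables of the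
  coefficients. The latter makes \<open>delbar i\<close> vanish for i \<ge> N, so that
  differentiating creates no coefficients beyond N.\<close>

definition tempered_form :: "nat \<Rightarrow> nat \<Rightarrow> nat \<Rightarrow> form \<Rightarrow> bool" where
  "tempered_form N s t f \<longleftrightarrow> (\<forall>I\<in>multi_indices s. \<forall>J\<in>multi_indices t.
     tempered (f I J) \<and> depends_on N (f I J) \<and>
     (f I J \<noteq> (\<lambda>_. 0) \<longrightarrow> I \<in> bounded_indices N s \<and> J \<in> bounded_indices N t))"

lemma tempered_formD:
  assumes "tempered_form N s t f" "I \<in> multi_indices s" "J \<in> multi_indices t"
  shows "tempered (f I J)" "depends_on N (f I J)"
    and "\<not> (I \<in> bounded_indices N s \<and> J \<in> bounded_indices N t) \<Longrightarrow> f I J = (\<lambda>_. 0)"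
  using assms unfolding tempered_form_def by blast+

lemma depends_on_delbar:
  assumes "depends_on N \<phi>"
  shows "depends_on N (delbar i \<phi>)"
  unfolding depends_on_def
proof (intro allI impI)
  fix z w :: cseq assume "\<forall>k<N. z k = w k"
  then have "pderiv_dir v i \<phi> z = pderiv_dir v i \<phi> w" for v
    using depends_on_pderiv_dir[OF assms] unfolding depends_on_def by blast
  then show "delbar i \<phi> z = delbar i \<phi> w" by (simp add: delbar_def)
qed

text \<open>Unlike \<open>delbar i\<close>, this operator brings in coordinate i itself by
  multiplication, hence the condition \<open>i < N\<close>.\<close>

lemma depends_on_delta:
  assumes "depends_on N \<phi>" "i < N"
  shows "depends_on N (\<delta> i \<phi>)"
  unfolding depends_on_def
proof (intro allI impI)
  fix z w :: cseq assume zw: "\<forall>k<N. z k = w k"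
  then have "pderiv_dir v i \<phi> z = pderiv_dir v i \<phi> w" for v
    using depends_on_pderiv_dir[OF assms(1)] unfolding depends_on_def by blast
  moreover have "\<phi> z = \<phi> w" "z i = w i"
    using assms zw unfolding depends_on_def by blast+
  ultimately show "\<delta> i \<phi> z = \<delta> i \<phi> w" by (simp add: delta_def del_def)
qed

lemma depends_on_lincomb_sum:
  "(\<And>i. i \<in> A \<Longrightarrow> depends_on N (\<phi> i)) \<Longrightarrow> depends_on N (\<lambda>z. \<Sum>i\<in>A. c i * \<phi> i z)"
  unfolding depends_on_def by (intro allI impI sum.cong refl arg_cong2[where f = "(*)"]) blast

lemma delbar_zero [simp]: "delbar i (\<lambda>_. 0) = (\<lambda>_. 0)"
  by (simp add: delbar_def pderiv_dir_def fun_eq_iff)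

lemma delta_zero [simp]: "\<delta> i (\<lambda>_. 0) = (\<lambda>_. 0)"
  by (simp add: delta_def del_def pderiv_dir_def fun_eq_iff)

lemma delbar_eq_0: "depends_on N \<phi> \<Longrightarrow> N \<le> i \<Longrightarrow> delbar i \<phi> = (\<lambda>_. 0)"
  by (simp add: delbar_def pderiv_dir_eq_0 fun_eq_iff)

lemma smooth_form_tempered:
  assumes "f \<in> smooth_forms s t"
  obtains N where "tempered_form N s t f"
proof -
  define Z where "Z = {(I, J) \<in> multi_indices s \<times> multi_indices t. f I J \<noteq> (\<lambda>_. 0)}"
  have Z: "finite Z" using assms by (simp add: smooth_forms_def Z_def)
  have C: "f I J \<in> Cc_smooth" if "I \<in> multi_indices s" "J \<in> multi_indices t" for I J
    using assms that by (auto simp: smooth_forms_def)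
  have "\<forall>p\<in>Z. \<exists>n. depends_on n (f (fst p) (snd p)) \<and> set (fst p) \<subseteq> {..<n} \<and> set (snd p) \<subseteq> {..<n}"
  proof
    fix p assume "p \<in> Z"
    then obtain I J where p: "p = (I, J)" "I \<in> multi_indices s" "J \<in> multi_indices t"
      by (auto simp: Z_def)
    from Cc_smoothE[OF C[OF p(2,3)]] obtain n where n: "depends_on n (f I J)" by metis
    obtain m where m: "\<forall>x\<in>set I \<union> set J. x < m"
      using finite_nat_set_iff_bounded[of "set I \<union> set J"] by auto
    then show "\<exists>n. depends_on n (f (fst p) (snd p)) \<and> set (fst p) \<subseteq> {..<n} \<and> set (snd p) \<subseteq> {..<n}"
      using depends_on_mono[OF n, of "max n m"] p(1) by (intro exI[of _ "max n m"]) (auto simp: less_max_iff_disj)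
  qed
  then obtain \<nu> where \<nu>: "\<And>p. p \<in> Z \<Longrightarrow> depends_on (\<nu> p) (f (fst p) (snd p)) \<and>
      set (fst p) \<subseteq> {..<\<nu> p} \<and> set (snd p) \<subseteq> {..<\<nu> p}"
    by metis
  \<comment> \<open>The sum is a common upper bound of the finitely many \<nu> p, and it also makes
    sense for empty \<open>Z\<close>.\<close>
  define N where "N = sum \<nu> Z"
  have N: "\<nu> p \<le> N" if "p \<in> Z" for p
    unfolding N_def using Z that by (intro member_le_sum) auto
  have "tempered_form N s t f"
    unfolding tempered_form_def
  proof (intro ballI conjI impI)
    fix I J assume IJ: "I \<in> multi_indices s" "J \<in> multi_indices t"
    show "tempered (f I J)" by (rule Cc_smooth_tempered[OF C[OF IJ]])
    have nz: "depends_on (\<nu> (I, J)) (f I J)" "set I \<subseteq> {..<\<nu> (I, J)}" "set J \<subseteq> {..<\<nu> (I, J)}" "\<nu> (I, J) \<le> N"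
      if "f I J \<noteq> (\<lambda>_. 0)"
      using \<nu>[of "(I, J)"] N[of "(I, J)"] IJ that by (auto simp: Z_def)
    show "depends_on N (f I J)"
      using nz depends_on_mono by (cases "f I J = (\<lambda>_. 0)") (auto simp: depends_on_def)
    show "I \<in> bounded_indices N s" "J \<in> bounded_indices N t" if "f I J \<noteq> (\<lambda>_. 0)"
      using nz[OF that] IJ by (auto simp: bounded_indices_def)
  qed
  then show thesis by (rule that)
qed

lemma form_norm_sq_eq:
  assumes "tempered_form N s t f"
  shows "form_norm_sq r a s t f =
    (\<Sum>I\<in>bounded_indices N s. \<Sum>J\<in>bounded_indices N t. weight a I J * nsq (f I J))"
proof -
  have "form_norm_sq r a s t f =
      (\<Sum>\<^sub>\<infinity>(I, J)\<in>bounded_indices N s \<times> bounded_indices N t. weight a I J * nsq (f I J))"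
    unfolding form_norm_sq_def nsq_def[symmetric]
    by (rule infsum_cong_neutral) (use bounded_indices_subset tempered_formD(3)[OF assms] in fastforce)+
  then show ?thesis by (simp add: sum.cartesian_product)
qed

lemma tempered_form_L2:
  assumes "tempered_form N s t f"
  shows "f \<in> L2_forms r a s t"
proof -
  have "(\<lambda>(I, J). weight a I J * nsq (f I J)) summable_on (multi_indices s \<times> multi_indices t) \<longleftrightarrow>
      (\<lambda>(I, J). weight a I J * nsq (f I J)) summable_on (bounded_indices N s \<times> bounded_indices N t)"
    by (rule summable_on_cong_neutral) (use bounded_indices_subset tempered_formD(3)[OF assms] in fastforce)+
  then show ?thesis
    using tempered_formD(1)[OF assms] by (auto simp: L2_forms_def nsq_def intro: tempered_L2)
qed

text \<open>One tempered partner is enough, because its zero coefficients cut off the sum. The other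
  form may then be an arbitrary candidate for \<open>dbar\<close> or
  \<open>dbar_adj\<close>.\<close>

lemma form_inner_eq:
  assumes "tempered_form N s t f \<or> tempered_form N s t g"
  shows "form_inner r a s t f g = (\<Sum>I\<in>bounded_indices N s. \<Sum>J\<in>bounded_indices N t.
    complex_of_real (weight a I J) * ip (f I J) (g I J))"
proof -
  have 0: "f I J = (\<lambda>_. 0) \<or> g I J = (\<lambda>_. 0)"
    if "I \<in> multi_indices s" "J \<in> multi_indices t" "\<not> (I \<in> bounded_indices N s \<and> J \<in> bounded_indices N t)" for I J
    using assms tempered_formD(3) that by blast
  have 0: "ip (f I J) (g I J) = 0"
    if "I \<in> multi_indices s" "J \<in> multi_indices t" "\<not> (I \<in> bounded_indices N s \<and> J \<in> bounded_indices N t)" for I J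
    using 0[OF that] by (auto simp: ip_def)
  have "form_inner r a s t f g = (\<Sum>\<^sub>\<infinity>(I, J)\<in>bounded_indices N s \<times> bounded_indices N t.
      complex_of_real (weight a I J) * ip (f I J) (g I J))"
    unfolding form_inner_def ip_def[symmetric]
    by (rule infsum_cong_neutral) (use bounded_indices_subset 0 in fastforce)+
  then show ?thesis by (simp add: sum.cartesian_product)
qed

subsection \<open>The weak dbar operator\<close>

abbreviation rsign :: "nat \<Rightarrow> nat list \<Rightarrow> real" where
  "rsign i J \<equiv> real_of_int (isign i J)"

lemma L2_formsD: "f \<in> L2_forms r a s t \<Longrightarrow> I \<in> multi_indices s \<Longrightarrow> J \<in> multi_indices t \<Longrightarrow> f I J \<in> L2 r a"
  by (auto simp: L2_forms_def)

text \<open>For fixed K only the entries i of K and J = K - i contribute. Exchanging the finite sum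
  with the integral needs every product to be integrable: the coefficients of f are in
  \<open>L2\<close>, and so is \<delta> of a test function.\<close>

lemma is_weak_dbar_iff:
  assumes f: "f \<in> L2_forms r a s t"
  shows "is_weak_dbar r a s t f g \<longleftrightarrow> g \<in> L2_forms r a s (Suc t) \<and>
    (\<forall>I\<in>multi_indices s. \<forall>K\<in>multi_indices (Suc t). \<forall>\<phi>\<in>Cc_smooth.
      ip (g I K) \<phi> = - (\<Sum>i\<in>set K. complex_of_real (rsign i (remove1 i K)) * ip (f I (remove1 i K)) (\<delta> i \<phi>)))"
proof -
  have "(\<integral>z. (\<Sum>\<^sub>\<infinity>i\<in>UNIV. \<Sum>\<^sub>\<infinity>J\<in>multi_indices t. of_int (eps K i J) * f I J z * cnj (\<delta> i \<phi> z)) \<partial>P) =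
      (\<Sum>i\<in>set K. complex_of_real (rsign i (remove1 i K)) * ip (f I (remove1 i K)) (\<delta> i \<phi>))"
    if IK: "I \<in> multi_indices s" "K \<in> multi_indices (Suc t)" and \<phi>: "\<phi> \<in> Cc_smooth" for I K \<phi>
  proof -
    have "(\<integral>z. (\<Sum>\<^sub>\<infinity>i\<in>UNIV. \<Sum>\<^sub>\<infinity>J\<in>multi_indices t. of_int (eps K i J) * f I J z * cnj (\<delta> i \<phi> z)) \<partial>P) =
        (\<integral>z. (\<Sum>i\<in>set K. of_int (isign i (remove1 i K)) * (f I (remove1 i K) z * cnj (\<delta> i \<phi> z))) \<partial>P)"
      unfolding mult.assoc infsum_eps[OF IK(2)] ..
    also have "\<dots> = (\<Sum>i\<in>set K. \<integral>z. of_int (isign i (remove1 i K)) * (f I (remove1 i K) z * cnj (\<delta> i \<phi> z)) \<partial>P)"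
      using multi_indices_remove1[OF IK(2)] Cc_smooth_tempered[OF \<phi>]
      by (intro Bochner_Integration.integral_sum integrable_mult_right L2_mult_cnj_integrable
          L2_formsD[OF f] IK tempered_L2 tempered_delta) auto
    finally show ?thesis by (simp add: ip_def)
  qed
  then show ?thesis
    unfolding is_weak_dbar_def ip_def[symmetric] Suc_eq_plus1[symmetric] by auto
qed

text \<open>Matches \<open>is_weak_dbar\<close>, hence carries no factor (-1)^s; that factor is
  added by \<open>dbar\<close>.\<close>

definition classical_dbar :: "form \<Rightarrow> form" where
  "classical_dbar f I K = (\<lambda>z. \<Sum>i\<in>set K. complex_of_real (rsign i (remove1 i K)) * delbar i (f I (remove1 i K)) z)"

lemma tempered_classical_dbar:
  assumes f: "tempered_form N s t f"
  shows "tempered_form N s (Suc t) (classical_dbar f)"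
  unfolding tempered_form_def
proof (intro ballI conjI impI)
  fix I K assume IK: "I \<in> multi_indices s" "K \<in> multi_indices (Suc t)"
  note fD = tempered_formD[OF f IK(1) multi_indices_remove1[OF IK(2)]]
  show "tempered (classical_dbar f I K)"
    unfolding classical_dbar_def using fD(1) by (intro tempered_sum tempered_cmult tempered_delbar)
  show "depends_on N (classical_dbar f I K)"
    unfolding classical_dbar_def using fD(2) by (intro depends_on_lincomb_sum depends_on_delbar)
  assume "classical_dbar f I K \<noteq> (\<lambda>_. 0)"
  then have "\<exists>i\<in>set K. delbar i (f I (remove1 i K)) \<noteq> (\<lambda>_. 0)"
    unfolding classical_dbar_def by (metis (mono_tags, lifting) mult_zero_right sum.neutral)
  then obtain i where i: "i \<in> set K" "delbar i (f I (remove1 i K)) \<noteq> (\<lambda>_. 0)" by blast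
  \<comment> \<open>The index i could a priori be any entry of K. It lies below N because a
    derivative in a variable on which f does not depend is zero; the other entries of K come from a
    nonzero coefficient of f.\<close>
  have "i < N" using delbar_eq_0[OF fD(2)[OF i(1)]] i(2) by (meson not_less)
  moreover have b: "I \<in> bounded_indices N s" "remove1 i K \<in> bounded_indices N t"
    using fD(3)[OF i(1)] i(2) by fastforce+
  moreover have "set K = insert i (set (remove1 i K))"
    using multi_indices_distinct[OF IK(2)] i(1) by (auto simp: set_remove1_eq)
  ultimately show "I \<in> bounded_indices N s" "K \<in> bounded_indices N (Suc t)"
    using IK(2) by (auto simp: bounded_indices_def)
qed

lemma is_weak_dbar_classical:
  assumes f: "tempered_form N s t f"
  shows "is_weak_dbar r a s t f (classical_dbar f)"
  unfolding is_weak_dbar_iff[OF tempered_form_L2[OF f]]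
proof (intro conjI ballI)
  show "classical_dbar f \<in> L2_forms r a s (Suc t)"
    by (rule tempered_form_L2[OF tempered_classical_dbar[OF f]])
  fix I K \<phi> assume IK: "I \<in> multi_indices s" "K \<in> multi_indices (Suc t)" and "\<phi> \<in> Cc_smooth"
  then have \<phi>: "tempered \<phi>" by (intro Cc_smooth_tempered)
  note fD = tempered_formD(1)[OF f IK(1) multi_indices_remove1[OF IK(2)]]
  have "ip (classical_dbar f I K) \<phi> =
      (\<Sum>i\<in>set K. complex_of_real (rsign i (remove1 i K)) * ip (delbar i (f I (remove1 i K))) \<phi>)"
    unfolding classical_dbar_def
    using fD \<phi> by (intro ip_sum_left tempered_L2 tempered_delbar) auto
  also have "\<dots> = (\<Sum>i\<in>set K. - (complex_of_real (rsign i (remove1 i K)) * ip (f I (remove1 i K)) (\<delta> i \<phi>)))"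
    using delbar_adjoint[OF fD \<phi>] by (intro sum.cong refl) simp
  finally show "ip (classical_dbar f I K) \<phi> =
      - (\<Sum>i\<in>set K. complex_of_real (rsign i (remove1 i K)) * ip (f I (remove1 i K)) (\<delta> i \<phi>))"
    by (simp add: sum_negf)
qed

lemma tempered_form_dbar_dom: "tempered_form N s t f \<Longrightarrow> f \<in> dbar_dom r a s t"
  unfolding dbar_dom_def using is_weak_dbar_classical tempered_form_L2 by blast

lemma is_weak_dbar_some:
  assumes "f \<in> dbar_dom r a s t"
  shows "is_weak_dbar r a s t f (SOME g. is_weak_dbar r a s t f g)"
  using assms unfolding dbar_dom_def mem_Collect_eq by (rule someI_ex[OF conjunct2])

text \<open>The classical coefficients are tested derivative by derivative: a sum of functions in
  \<^const>\<open>Cc_smooth\<close> that depend on different numbers of coordinates need not be in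
  \<^const>\<open>Cc_smooth\<close>.\<close>

lemma weak_dbar_norm_ge:
  assumes f: "f \<in> smooth_forms s t" and g: "is_weak_dbar r a s t f g"
  shows "form_norm_sq r a s (Suc t) (classical_dbar f) \<le> form_norm_sq r a s (Suc t) g"
proof -
  obtain N where N: "tempered_form N s t f" by (rule smooth_form_tempered[OF f])
  note fL2 = tempered_form_L2[OF N]
  note g0 = is_weak_dbar_classical[OF N]
  have L2: "g \<in> L2_forms r a s (Suc t)" "classical_dbar f \<in> L2_forms r a s (Suc t)"
    using g g0 by (auto simp: is_weak_dbar_def)
  have le: "nsq (classical_dbar f I K) \<le> nsq (g I K)"
    if IK: "I \<in> multi_indices s" "K \<in> multi_indices (Suc t)" for I K
  proof -
    note gL2 = L2_formsD[OF L2(1) IK] L2_formsD[OF L2(2) IK]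
    have eq: "ip (g I K) \<phi> = ip (classical_dbar f I K) \<phi>" if "\<phi> \<in> Cc_smooth" for \<phi>
      using g g0 IK that unfolding is_weak_dbar_iff[OF fL2] by simp
    have C: "pderiv_dir v i (f I (remove1 i K)) \<in> Cc_smooth" if "i \<in> set K" "v \<in> directions" for v i
      using f IK that multi_indices_remove1[OF IK(2)] by (intro Cc_smooth_pderiv_dir) (auto simp: smooth_forms_def)
    have "ip u (classical_dbar f I K) = (\<Sum>i\<in>set K. complex_of_real (rsign i (remove1 i K)) *
        ((1/2) * ip u (pderiv_dir 1 i (f I (remove1 i K))) + (-\<i>/2) * ip u (pderiv_dir \<i> i (f I (remove1 i K)))))"
      if u: "u \<in> L2 r a" for u
    proof -
      have "ip u (delbar i (f I (remove1 i K))) =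
          (1/2) * ip u (pderiv_dir 1 i (f I (remove1 i K))) + (-\<i>/2) * ip u (pderiv_dir \<i> i (f I (remove1 i K)))"
        if i: "i \<in> set K" for i
      proof -
        \<comment> \<open>The two directions serve as a finite index set for
          \<open>ip_sum_right\<close>; conjugation in the second argument turns \<i>/2 into
          -\<i>/2.\<close>
        have "ip u (\<lambda>z. \<Sum>v\<in>directions. (if v = 1 then 1/2 else \<i>/2) * pderiv_dir v i (f I (remove1 i K)) z) =
            (\<Sum>v\<in>directions. cnj (if v = 1 then 1/2 else \<i>/2) * ip u (pderiv_dir v i (f I (remove1 i K))))"
          by (rule ip_sum_right) (use C[OF i] u in \<open>auto intro: tempered_L2 Cc_smooth_tempered\<close>)
        then show ?thesis by (simp add: delbar_eq)
      qed
      moreover have "tempered (delbar i (f I (remove1 i K)))" if "i \<in> set K" for i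
        using tempered_formD(1)[OF N IK(1) multi_indices_remove1[OF IK(2) that]] by (rule tempered_delbar)
      ultimately show ?thesis
        unfolding classical_dbar_def using u by (subst ip_sum_right) (auto intro: tempered_L2)
    qed
    from this[OF gL2(1)] this[OF gL2(2)] have "ip (g I K) (classical_dbar f I K) = ip (classical_dbar f I K) (classical_dbar f I K)"
      by (simp add: eq[OF C])
    then have "Re (ip (g I K) (classical_dbar f I K)) = nsq (classical_dbar f I K)"
      by (simp add: Re_ip_self)
    then show ?thesis using Re_ip_le[OF gL2] by simp
  qed
  show ?thesis
    unfolding form_norm_sq_def nsq_def[symmetric]
  proof (rule infsum_mono)
    show "(\<lambda>(I, J). weight a I J * nsq (classical_dbar f I J)) summable_on multi_indices s \<times> multi_indices (Suc t)"
      "(\<lambda>(I, J). weight a I J * nsq (g I J)) summable_on multi_indices s \<times> multi_indices (Suc t)"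
      using L2 by (auto simp: L2_forms_def nsq_def)
  qed (use le weight_nonneg in \<open>auto intro: mult_left_mono\<close>)
qed

subsection \<open>The adjoint\<close>

text \<open>The factor a_i^2 is the ratio of the weights at J + i and J. The sign (-1)^(s+1) joins
  the (-1)^s of \<open>dbar\<close> to the minus sign of the adjoint relation. Stopping at N loses
  nothing for a form whose coefficients vanish beyond N.\<close>

definition classical_adj :: "nat \<Rightarrow> nat \<Rightarrow> form \<Rightarrow> form" where
  "classical_adj N s f I J = (\<lambda>z. (-1) ^ Suc s *
     (\<Sum>i\<in>{..<N} - set J. complex_of_real ((a i)\<^sup>2 * rsign i J) * \<delta> i (f I (insort i J)) z))"

lemma classical_adj_alt: "classical_adj N s f I J = (\<lambda>z.
    \<Sum>i\<in>{..<N} - set J. complex_of_real ((-1) ^ Suc s * ((a i)\<^sup>2 * rsign i J)) * \<delta> i (f I (insort i J)) z)"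
  unfolding classical_adj_def sum_distrib_left by (simp add: mult.assoc)

lemma tempered_classical_adj:
  assumes f: "tempered_form N s (Suc t) f"
  shows "tempered_form N s t (classical_adj N s f)"
  unfolding tempered_form_def
proof (intro ballI conjI impI)
  fix I J assume IJ: "I \<in> multi_indices s" "J \<in> multi_indices t"
  have fD: "tempered (f I (insort i J))" "depends_on N (f I (insort i J))"
    "\<not> (I \<in> bounded_indices N s \<and> insort i J \<in> bounded_indices N (Suc t)) \<Longrightarrow> f I (insort i J) = (\<lambda>_. 0)"
    if "i \<in> {..<N} - set J" for i
    using tempered_formD[OF f IJ(1) multi_indices_insort[OF IJ(2)]] that by auto
  show "tempered (classical_adj N s f I J)"
    unfolding classical_adj_alt using fD(1) by (intro tempered_sum tempered_cmult tempered_delta)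
  show "depends_on N (classical_adj N s f I J)"
    unfolding classical_adj_alt using fD(2) by (intro depends_on_lincomb_sum depends_on_delta) auto
  assume "classical_adj N s f I J \<noteq> (\<lambda>_. 0)"
  then have "\<exists>i\<in>{..<N} - set J. \<delta> i (f I (insort i J)) \<noteq> (\<lambda>_. 0)"
    unfolding classical_adj_alt by (metis (mono_tags, lifting) mult_zero_right sum.neutral)
  then obtain i where i: "i \<in> {..<N} - set J" "\<delta> i (f I (insort i J)) \<noteq> (\<lambda>_. 0)" by blast
  then have "I \<in> bounded_indices N s" "insort i J \<in> bounded_indices N (Suc t)"
    using fD(3)[OF i(1)] by fastforce+
  then show "I \<in> bounded_indices N s" "J \<in> bounded_indices N t"
    using IJ by (auto simp: bounded_indices_def set_insort_key)
qed

text \<open>The coefficients of f are themselves admissible test functions in the weak identity of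
  u, so all derivatives land on f and nothing is asked of u beyond its membership in the domain.
  Summation over K and i in K is then regrouped by J = K - i.\<close>

lemma is_dbar_adj_classical:
  assumes fs: "f \<in> smooth_forms s (Suc t)" and f: "tempered_form N s (Suc t) f"
  shows "is_dbar_adj r a s t f (classical_adj N s f)"
  unfolding is_dbar_adj_def
proof (intro conjI ballI)
  note adj = tempered_classical_adj[OF f]
  show "classical_adj N s f \<in> L2_forms r a s t" by (rule tempered_form_L2[OF adj])
  fix u assume u: "u \<in> dbar_dom r a s t"
  then have uL2: "u \<in> L2_forms r a s t" by (simp add: dbar_dom_def)
  define g where "g = (SOME g. is_weak_dbar r a s t u g)"
  have "is_weak_dbar r a s t u g"
    unfolding g_def by (rule is_weak_dbar_some[OF u])
  then have g: "g \<in> L2_forms r a s (Suc t)"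
    and weak: "\<And>I K \<phi>. I \<in> multi_indices s \<Longrightarrow> K \<in> multi_indices (Suc t) \<Longrightarrow> \<phi> \<in> Cc_smooth \<Longrightarrow>
      ip (g I K) \<phi> = - (\<Sum>i\<in>set K. complex_of_real (rsign i (remove1 i K)) * ip (u I (remove1 i K)) (\<delta> i \<phi>))"
    unfolding is_weak_dbar_iff[OF uL2] by auto
  have left: "(\<Sum>K\<in>bounded_indices N (Suc t). complex_of_real (weight a I K) * ip (dbar r a s t u I K) (f I K)) =
      (\<Sum>J\<in>bounded_indices N t. complex_of_real (weight a I J) * ip (u I J) (classical_adj N s f I J))"
    if "I \<in> bounded_indices N s" for I
  proof -
    have I: "I \<in> multi_indices s" using that bounded_indices_subset by blast
    define H where "H i J K = (-1) ^ Suc s * complex_of_real (weight a I K) *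
      (complex_of_real (rsign i J) * ip (u I J) (\<delta> i (f I K)))" for i J K
    have "(\<Sum>K\<in>bounded_indices N (Suc t). complex_of_real (weight a I K) * ip (dbar r a s t u I K) (f I K)) =
        (\<Sum>K\<in>bounded_indices N (Suc t). \<Sum>i\<in>set K. H i (remove1 i K) K)"
    proof (rule sum.cong[OF refl])
      fix K assume "K \<in> bounded_indices N (Suc t)"
      then have K: "K \<in> multi_indices (Suc t)" using bounded_indices_subset by blast
      have "ip (dbar r a s t u I K) (f I K) = (-1) ^ s * ip (g I K) (f I K)"
        unfolding dbar_def g_def[symmetric] ip_def by (simp add: mult.assoc)
      then show "complex_of_real (weight a I K) * ip (dbar r a s t u I K) (f I K) = (\<Sum>i\<in>set K. H i (remove1 i K) K)"
        using weak[OF I K, of "f I K"] fs I K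
        by (simp add: smooth_forms_def H_def sum_distrib_left sum_negf mult.assoc mult.left_commute)
    qed
    also have "\<dots> = (\<Sum>J\<in>bounded_indices N t. \<Sum>i\<in>{..<N} - set J. H i J (insort i J))"
      by (rule sum_bounded_indices_Suc)
    also have "\<dots> = (\<Sum>J\<in>bounded_indices N t. complex_of_real (weight a I J) * ip (u I J) (classical_adj N s f I J))"
    proof (rule sum.cong[OF refl])
      fix J assume "J \<in> bounded_indices N t"
      then have J: "J \<in> multi_indices t" using bounded_indices_subset by blast
      have "ip (u I J) (classical_adj N s f I J) = (\<Sum>i\<in>{..<N} - set J.
          cnj (complex_of_real ((-1) ^ Suc s * ((a i)\<^sup>2 * rsign i J))) * ip (u I J) (\<delta> i (f I (insort i J))))"
        unfolding classical_adj_alt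
        by (rule ip_sum_right)
          (use L2_formsD[OF uL2 I J] tempered_formD(1)[OF f I multi_indices_insort[OF J]]
            in \<open>auto intro: tempered_L2 tempered_delta\<close>)
      then show "(\<Sum>i\<in>{..<N} - set J. H i J (insort i J)) =
          complex_of_real (weight a I J) * ip (u I J) (classical_adj N s f I J)"
        by (simp add: H_def weight_eq iweight_insort sum_distrib_left ac_simps)
    qed
    finally show ?thesis .
  qed
  show "form_inner r a s (t + 1) (dbar r a s t u) f = form_inner r a s t u (classical_adj N s f)"
    unfolding Suc_eq_plus1[symmetric] form_inner_eq[OF disjI2[OF f]] form_inner_eq[OF disjI2[OF adj]]
    using left by (rule sum.cong[OF refl])
qed

lemma dbar_adj_norm_ge:
  assumes f: "f \<in> smooth_forms s (Suc t)" "tempered_form N s (Suc t) f" and h: "is_dbar_adj r a s t f h"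
  shows "form_norm_sq r a s t (classical_adj N s f) \<le> form_norm_sq r a s t h"
proof -
  let ?h = "classical_adj N s f"
  let ?B = "bounded_indices N s \<times> bounded_indices N t"
  note adj = tempered_classical_adj[OF f(2)]
  have hL2: "h \<in> L2_forms r a s t" using h by (simp add: is_dbar_adj_def)
  \<comment> \<open>Both adjoints are tested on u = \<open>?h\<close>, which is tempered and hence
    in the domain of \<open>dbar\<close>; each side equals the pairing of \<open>dbar\<close> of
    \<open>?h\<close> with f.\<close>
  have "form_inner r a s t ?h ?h = form_inner r a s t ?h h"
    using is_dbar_adj_classical[OF f] h tempered_form_dbar_dom[OF adj]
    unfolding is_dbar_adj_def by metis
  then have "(\<Sum>(I, J)\<in>?B. complex_of_real (weight a I J) * ip (?h I J) (?h I J)) =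
      (\<Sum>(I, J)\<in>?B. complex_of_real (weight a I J) * ip (?h I J) (h I J))"
    unfolding form_inner_eq[OF disjI1[OF adj]] sum.cartesian_product by simp
  then have "Re (\<Sum>(I, J)\<in>?B. complex_of_real (weight a I J) * ip (?h I J) (?h I J)) =
      Re (\<Sum>(I, J)\<in>?B. complex_of_real (weight a I J) * ip (?h I J) (h I J))"
    by simp
  then have "(\<Sum>(I, J)\<in>?B. weight a I J * nsq (?h I J)) = (\<Sum>(I, J)\<in>?B. weight a I J * Re (ip (?h I J) (h I J)))"
    by (simp add: case_prod_unfold ip_self)
  also have "\<dots> \<le> (\<Sum>(I, J)\<in>?B. weight a I J * ((nsq (?h I J) + nsq (h I J)) / 2))"
  proof (rule sum_mono)
    fix p assume "p \<in> ?B"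
    then obtain I J where p: "p = (I, J)" "I \<in> multi_indices s" "J \<in> multi_indices t"
      using bounded_indices_subset by blast
    show "(case p of (I, J) \<Rightarrow> weight a I J * Re (ip (?h I J) (h I J)))
        \<le> (case p of (I, J) \<Rightarrow> weight a I J * ((nsq (?h I J) + nsq (h I J)) / 2))"
      using Re_ip_le[OF L2_formsD[OF tempered_form_L2[OF adj] p(2,3)] L2_formsD[OF hL2 p(2,3)]]
      unfolding p(1) prod.case by (intro mult_left_mono weight_nonneg) simp
  qed
  also have "\<dots> = ((\<Sum>(I, J)\<in>?B. weight a I J * nsq (?h I J)) + (\<Sum>(I, J)\<in>?B. weight a I J * nsq (h I J))) / 2"
    unfolding sum.distrib[symmetric] sum_divide_distrib
    by (intro sum.cong refl) (auto simp: algebra_simps add_divide_distrib)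
  finally have "(\<Sum>(I, J)\<in>?B. weight a I J * nsq (?h I J)) \<le> (\<Sum>(I, J)\<in>?B. weight a I J * nsq (h I J))"
    by simp
  \<comment> \<open>Outside the finite box nothing is known about \<open>h\<close>, but its
    remaining terms are nonnegative and can only enlarge the norm.\<close>
  also have "\<dots> \<le> form_norm_sq r a s t h"
    unfolding form_norm_sq_def nsq_def[symmetric]
    by (rule finite_sum_le_infsum)
      (use hL2 bounded_indices_subset weight_nonneg nsq_nonneg in \<open>auto simp: L2_forms_def nsq_def[symmetric]\<close>)
  finally show ?thesis
    using form_norm_sq_eq[OF adj] by (simp add: sum.cartesian_product)
qed

subsection \<open>The basic estimate\<close>

text \<open>The off-diagonal terms of the two squares are matched through
  \<open>L = J \<union> {i, j}\<close>; they cancel because of \<open>isign_insort\<close>.\<close>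

lemma basic_estimate_coefficients:
  fixes c :: "nat list \<Rightarrow> cseq \<Rightarrow> complex"
  assumes c: "\<And>K. K \<in> multi_indices (Suc t) \<Longrightarrow> tempered (c K)"
  shows "real (Suc t) / (2 * r\<^sup>2) * (\<Sum>K\<in>bounded_indices N (Suc t). iweight a K * nsq (c K)) \<le>
    (\<Sum>J\<in>bounded_indices N t. iweight a J * nsq (\<lambda>z. \<Sum>i\<in>{..<N} - set J.
        complex_of_real ((a i)\<^sup>2 * rsign i J) * \<delta> i (c (insort i J)) z)) +
    (\<Sum>L\<in>bounded_indices N (Suc (Suc t)). iweight a L * nsq (\<lambda>z. \<Sum>i\<in>set L.
        complex_of_real (rsign i (remove1 i L)) * delbar i (c (remove1 i L)) z))"
    (is "?lhs \<le> (\<Sum>J\<in>_. _ * nsq (?h J)) + (\<Sum>L\<in>_. _ * nsq (?g L))")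
proof -
  \<comment> \<open>The derivatives sit crosswise, j on J + i and i on J + j, as
    \<open>ip_delta_delta\<close> leaves them. For i \<noteq> j this is also a mixed term at L = J +
    i + j, where deleting i leaves J + j and deleting j leaves J + i.\<close>
  define X where "X i j J = Re (ip (delbar j (c (insort i J))) (delbar i (c (insort j J))))" for i j J
  define Y where "Y i j J = (a i)\<^sup>2 * (a j)\<^sup>2 * (rsign i J * rsign j J) * X i j J" for i j J
  have h: "(\<Sum>i\<in>{..<N} - set J. (a i)\<^sup>2 / (2 * r\<^sup>2) * nsq (c (insort i J)))
      + (\<Sum>i\<in>{..<N} - set J. \<Sum>j\<in>{..<N} - set J - {i}. Y i j J) \<le> nsq (?h J)"
    if J: "J \<in> multi_indices t" for J
  proof -
    have ct: "tempered (c (insort i J))" if "i \<in> {..<N} - set J" for i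
      using that by (intro c multi_indices_insort[OF J]) auto
    have "nsq (?h J) = (\<Sum>i\<in>{..<N} - set J. \<Sum>j\<in>{..<N} - set J. (a i)\<^sup>2 * rsign i J * ((a j)\<^sup>2 * rsign j J) *
        Re (ip (\<delta> i (c (insort i J))) (\<delta> j (c (insort j J)))))"
      by (rule nsq_sum) (auto intro!: tempered_delta ct)
    also have "\<dots> = (\<Sum>i\<in>{..<N} - set J. \<Sum>j\<in>{..<N} - set J.
        Y i j J + (if i = j then (a i)\<^sup>2 / (2 * r\<^sup>2) * nsq (c (insort i J)) else 0))"
    proof (intro sum.cong refl)
      fix i j assume ij: "i \<in> {..<N} - set J" "j \<in> {..<N} - set J"
      have "\<kappa> i * complex_of_real x = complex_of_real (x / (2 * r\<^sup>2 * (a i)\<^sup>2))" for x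
        by simp
      then have "Re (\<kappa> i * ip (c (insort i J)) (c (insort i J))) = nsq (c (insort i J)) / (2 * r\<^sup>2 * (a i)\<^sup>2)"
        unfolding ip_self by (simp only: Re_complex_of_real)
      \<comment> \<open>The squared sign is 1, and one of the two factors a_i^2 cancels against
        \<kappa> i. The other will complete the weight of J to that of J + i.\<close>
      moreover have "(a i)\<^sup>2 * rsign i J * ((a i)\<^sup>2 * rsign i J) * (x / (2 * r\<^sup>2 * (a i)\<^sup>2)) =
          (a i)\<^sup>2 / (2 * r\<^sup>2) * x" for x
      proof -
        have "rsign i J * rsign i J = 1"
          using isign_square[of i J] by (metis of_int_1 of_int_mult)
        then have sq: "(a i)\<^sup>2 * rsign i J * ((a i)\<^sup>2 * rsign i J) = (a i)\<^sup>2 * (a i)\<^sup>2"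
          by (simp add: mult.assoc mult.left_commute)
        have "A * A * (x / (2 * r\<^sup>2 * A)) = A / (2 * r\<^sup>2) * x" if "A \<noteq> 0" for A
          using that by simp
        then show ?thesis unfolding sq using a_pos[of i] by (metis less_numeral_extra(3) zero_less_power)
      qed
      ultimately show "(a i)\<^sup>2 * rsign i J * ((a j)\<^sup>2 * rsign j J) * Re (ip (\<delta> i (c (insort i J))) (\<delta> j (c (insort j J)))) =
          Y i j J + (if i = j then (a i)\<^sup>2 / (2 * r\<^sup>2) * nsq (c (insort i J)) else 0)"
        unfolding ip_delta_delta[OF ct[OF ij(1)] ct[OF ij(2)]] Y_def X_def
        by (cases "i = j") (simp_all add: distrib_left del: times_divide_eq_left times_divide_eq_right)
    qed
    also have "\<dots> = (\<Sum>i\<in>{..<N} - set J. Y i i J) +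
        (\<Sum>i\<in>{..<N} - set J. (a i)\<^sup>2 / (2 * r\<^sup>2) * nsq (c (insort i J)))
      + (\<Sum>i\<in>{..<N} - set J. \<Sum>j\<in>{..<N} - set J - {i}. Y i j J)"
      by (subst sum_diag_offdiag) (auto simp: sum.distrib intro!: sum.cong)
    finally have "nsq (?h J) = \<dots>" .
    moreover have "0 \<le> (\<Sum>i\<in>{..<N} - set J. Y i i J)"
      by (intro sum_nonneg) (simp add: Y_def X_def Re_ip_self nsq_nonneg)
    ultimately show ?thesis by linarith
  qed
  define Z where "Z i j L = rsign i (remove1 i L) * rsign j (remove1 j L) *
    Re (ip (delbar i (c (remove1 i L))) (delbar j (c (remove1 j L))))" for i j L
  have g: "(\<Sum>i\<in>set L. \<Sum>j\<in>set L - {i}. Z i j L) \<le> nsq (?g L)"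
    if L: "L \<in> multi_indices (Suc (Suc t))" for L
  proof -
    have "nsq (?g L) = (\<Sum>i\<in>set L. \<Sum>j\<in>set L. Z i j L)"
      unfolding Z_def
      by (rule nsq_sum) (auto intro!: tempered_delbar c multi_indices_remove1[OF L])
    also have "\<dots> = (\<Sum>i\<in>set L. Z i i L) + (\<Sum>i\<in>set L. \<Sum>j\<in>set L - {i}. Z i j L)"
      by (rule sum_diag_offdiag) simp
    finally have "nsq (?g L) = \<dots>" .
    moreover have "0 \<le> (\<Sum>i\<in>set L. Z i i L)"
      by (intro sum_nonneg) (simp add: Z_def Re_ip_self nsq_nonneg)
    ultimately show ?thesis by linarith
  qed
  \<comment> \<open>The factor t + 1 is spent here: each K is listed once for each of its
    entries.\<close>
  have "?lhs = (\<Sum>K\<in>bounded_indices N (Suc t). \<Sum>i\<in>set K. iweight a K / (2 * r\<^sup>2) * nsq (c K))"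
  proof -
    have "card (set K) = Suc t" if "K \<in> bounded_indices N (Suc t)" for K
      using that by (auto simp: bounded_indices_def multi_indices_def strict_sorted_iff distinct_card)
    then show ?thesis by (simp add: sum_distrib_left)
  qed
  also have "\<dots> = (\<Sum>J\<in>bounded_indices N t. \<Sum>i\<in>{..<N} - set J. iweight a (insort i J) / (2 * r\<^sup>2) * nsq (c (insort i J)))"
    by (rule sum_bounded_indices_Suc)
  also have "\<dots> = (\<Sum>J\<in>bounded_indices N t. iweight a J * (\<Sum>i\<in>{..<N} - set J. (a i)\<^sup>2 / (2 * r\<^sup>2) * nsq (c (insort i J))))"
    by (simp add: iweight_insort sum_distrib_left ac_simps)
  finally have lhs: "?lhs = \<dots>" .
  \<comment> \<open>Going from L down to J deletes i and then j, by two regroupings through M = L -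
    i. Between them the sums over i and j are exchanged, so that the second regrouping finds the
    entries j of M on the outside.\<close>
  have "(\<Sum>L\<in>bounded_indices N (Suc (Suc t)). iweight a L * (\<Sum>i\<in>set L. \<Sum>j\<in>set L - {i}. Z i j L)) =
      (\<Sum>L\<in>bounded_indices N (Suc (Suc t)). \<Sum>i\<in>set L. \<Sum>j\<in>set (remove1 i L). iweight a L * Z i j L)"
    using multi_indices_distinct bounded_indices_subset
    by (intro sum.cong refl) (fastforce simp: sum_distrib_left set_remove1_eq intro!: sum.cong)
  also have "\<dots> = (\<Sum>M\<in>bounded_indices N (Suc t). \<Sum>i\<in>{..<N} - set M. \<Sum>j\<in>set M. iweight a (insort i M) * Z i j (insort i M))"
    by (rule sum_bounded_indices_Suc)
  also have "\<dots> = (\<Sum>M\<in>bounded_indices N (Suc t). \<Sum>j\<in>set M. \<Sum>i\<in>{..<N} - set M. iweight a (insort i M) * Z i j (insort i M))"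
    by (rule sum.cong[OF refl], rule sum.swap)
  also have "\<dots> = (\<Sum>J\<in>bounded_indices N t. \<Sum>j\<in>{..<N} - set J. \<Sum>i\<in>{..<N} - set (insort j J).
      iweight a (insort i (insort j J)) * Z i j (insort i (insort j J)))"
    by (rule sum_bounded_indices_Suc)
  also have "\<dots> = (\<Sum>J\<in>bounded_indices N t. \<Sum>j\<in>{..<N} - set J. \<Sum>i\<in>{..<N} - set J - {j}. - (iweight a J * Y j i J))"
  proof (intro sum.cong refl)
    fix J j i assume "J \<in> bounded_indices N t" "j \<in> {..<N} - set J" and i': "i \<in> {..<N} - set J - {j}"
    then have i: "i \<noteq> j" "i \<notin> set J" "j \<notin> set J" by auto
    have r: "remove1 i (insort i (insort j J)) = insort j J" "remove1 j (insort i (insort j J)) = insort i J"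
      by (simp, subst insort_left_comm, simp)
    have "rsign i (insort j J) * rsign j (insort i J) = - (rsign i J * rsign j J)"
      using isign_insort[OF i] by (metis of_int_minus of_int_mult)
    then show "iweight a (insort i (insort j J)) * Z i j (insort i (insort j J)) = - (iweight a J * Y j i J)"
      by (simp add: Z_def Y_def X_def r iweight_insort ac_simps)
  qed (auto simp: set_insort_key)
  also have "\<dots> = - (\<Sum>J\<in>bounded_indices N t. iweight a J * (\<Sum>i\<in>{..<N} - set J. \<Sum>j\<in>{..<N} - set J - {i}. Y i j J))"
    by (simp add: sum_negf sum_distrib_left)
  finally have off: "(\<Sum>L\<in>bounded_indices N (Suc (Suc t)). iweight a L * (\<Sum>i\<in>set L. \<Sum>j\<in>set L - {i}. Z i j L)) = \<dots>" .
  have "?lhs + (\<Sum>J\<in>bounded_indices N t. iweight a J * (\<Sum>i\<in>{..<N} - set J. \<Sum>j\<in>{..<N} - set J - {i}. Y i j J))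
      \<le> (\<Sum>J\<in>bounded_indices N t. iweight a J * nsq (?h J))"
  proof -
    have "(\<Sum>J\<in>bounded_indices N t. iweight a J * ((\<Sum>i\<in>{..<N} - set J. (a i)\<^sup>2 / (2 * r\<^sup>2) * nsq (c (insort i J)))
          + (\<Sum>i\<in>{..<N} - set J. \<Sum>j\<in>{..<N} - set J - {i}. Y i j J)))
        \<le> (\<Sum>J\<in>bounded_indices N t. iweight a J * nsq (?h J))"
      by (intro sum_mono mult_left_mono h iweight_nonneg) (use bounded_indices_subset in blast)
    then show ?thesis by (simp only: lhs distrib_left sum.distrib[of "\<lambda>J. iweight a J * _ J"])
  qed
  moreover have "(\<Sum>L\<in>bounded_indices N (Suc (Suc t)). iweight a L * (\<Sum>i\<in>set L. \<Sum>j\<in>set L - {i}. Z i j L))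
      \<le> (\<Sum>L\<in>bounded_indices N (Suc (Suc t)). iweight a L * nsq (?g L))"
    by (intro sum_mono mult_left_mono g iweight_nonneg) (use bounded_indices_subset in blast)
  ultimately show ?thesis using off by linarith
qed

text \<open>The index I is a mere parameter: the estimate for the coefficients at fixed I is
  multiplied by the weight of I and summed. The sign of the classical adjoint does not affect
  norms.\<close>

lemma basic_estimate:
  assumes f: "tempered_form N s (Suc t) f"
  shows "real (Suc t) / (2 * r\<^sup>2) * form_norm_sq r a s (Suc t) f \<le>
    form_norm_sq r a s t (classical_adj N s f) + form_norm_sq r a s (Suc (Suc t)) (classical_dbar f)"
proof -
  have adj: "nsq (classical_adj N s f I J) = nsq (\<lambda>z. \<Sum>i\<in>{..<N} - set J.
      complex_of_real ((a i)\<^sup>2 * rsign i J) * \<delta> i (f I (insort i J)) z)" for I J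
    unfolding classical_adj_def nsq_def by (simp add: norm_mult norm_power)
  have "real (Suc t) / (2 * r\<^sup>2) * form_norm_sq r a s (Suc t) f =
      (\<Sum>I\<in>bounded_indices N s. iweight a I * (real (Suc t) / (2 * r\<^sup>2) *
        (\<Sum>K\<in>bounded_indices N (Suc t). iweight a K * nsq (f I K))))"
    unfolding form_norm_sq_eq[OF f] weight_eq by (simp add: sum_distrib_left ac_simps)
  also have "\<dots> \<le> (\<Sum>I\<in>bounded_indices N s. iweight a I *
      ((\<Sum>J\<in>bounded_indices N t. iweight a J * nsq (classical_adj N s f I J)) +
       (\<Sum>L\<in>bounded_indices N (Suc (Suc t)). iweight a L * nsq (classical_dbar f I L))))"
    unfolding adj classical_dbar_def
    using bounded_indices_subset tempered_formD(1)[OF f]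
    by (intro sum_mono mult_left_mono basic_estimate_coefficients iweight_nonneg) blast
  also have "\<dots> = form_norm_sq r a s t (classical_adj N s f) + form_norm_sq r a s (Suc (Suc t)) (classical_dbar f)"
    unfolding form_norm_sq_eq[OF tempered_classical_adj[OF f]]
      form_norm_sq_eq[OF tempered_classical_dbar[OF f]] weight_eq
    by (simp add: sum_distrib_left sum.distrib distrib_left mult.assoc)
  finally show ?thesis .
qed

end

theorem theorem117:
  fixes r :: real and a :: "nat \<Rightarrow> real" and s t :: nat and f :: form
  assumes "r > 0" and "\<And>i. a i > 0" and "summable a"
    and "f \<in> smooth_forms s (t + 1)"
  shows "f \<in> dbar_dom r a s (t + 1) \<inter> dbar_adj_dom r a s t \<and>
    real (t + 1) / (2 * r\<^sup>2) * form_norm_sq r a s (t + 1) f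
      \<le> form_norm_sq r a s t (dbar_adj r a s t f)
        + form_norm_sq r a s (t + 2) (dbar r a s (t + 1) f)"
proof -
  interpret gaussian_ell2 r a using assms(1,2) by unfold_locales
  have f: "f \<in> smooth_forms s (Suc t)" using assms(4) by simp
  obtain N where N: "tempered_form N s (Suc t) f" by (rule smooth_form_tempered[OF f])
  have dom: "f \<in> dbar_dom r a s (Suc t)" by (rule tempered_form_dbar_dom[OF N])
  note adj = is_dbar_adj_classical[OF f N]
  have adj_dom: "f \<in> dbar_adj_dom r a s t"
    unfolding dbar_adj_dom_def using adj tempered_form_L2[OF N] by auto
  have "is_dbar_adj r a s t f (dbar_adj r a s t f)"
    unfolding dbar_adj_def by (rule someI[of "is_dbar_adj r a s t f", OF adj])
  from dbar_adj_norm_ge[OF f N this]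
  have 1: "form_norm_sq r a s t (classical_adj N s f) \<le> form_norm_sq r a s t (dbar_adj r a s t f)" .
  \<comment> \<open>The choice in \<open>dbar\<close> is multiplied by (-1)^s, which has modulus 1,
    so the lower bound for arbitrary weak solutions carries over.\<close>
  have "form_norm_sq r a s (t + 2) (dbar r a s (t + 1) f) =
      form_norm_sq r a s (Suc (Suc t)) (SOME g. is_weak_dbar r a s (Suc t) f g)"
    unfolding form_norm_sq_def dbar_def by (simp add: norm_mult norm_power)
  then have 2: "form_norm_sq r a s (Suc (Suc t)) (classical_dbar f) \<le> form_norm_sq r a s (t + 2) (dbar r a s (t + 1) f)"
    using weak_dbar_norm_ge[OF f is_weak_dbar_some[OF dom]] by simp
  show ?thesis
    using dom adj_dom basic_estimate[OF N] 1 2 by simp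
qed

end
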